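(* Let $N\in\mathbb{N}$, $N>0$, let $\psi_1,\dots,\psi_N\in\mathcal{D}(\mathcal{A})$ be linearly independent dictionary functions with span $\mathcal{F}_N$, and let $\mathcal{A}_{N,\Delta t}:\mathcal{F}_N\to\mathcal{F}_N$ (for $\Delta t>0$) and $\mathcal{A}_N=\mathcal{P}_N\mathcal{A}\mathcal{P}_N$ be as defined in the context. Assume that $\mathcal{O}\subset\mathcal{M}$ is a compact set that (almost surely) contains all sampled data points and that there are constants $C,L>0$ with $|\psi_i(x)|\le C$ and $|\mathcal{A}\psi_i(x)|\le L$ for all $x\in\mathcal{O}$ and $i=1,\dots,N$. Then $$\lim_{\Delta t\to0}\|\mathcal{A}_{N,\Delta t}-\mathcal{A}_N\|=0,$$ where $\|\cdot\|$ is the operator norm for linear maps $\mathcal{F}_N\to\mathcal{F}_N$.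
   Context: Setting: $\mathcal{M}\subseteq\mathbb{R}^d$ is the state space with its Borel $\sigma$-algebra; $(\mathbf{X}_t)_{t\ge0}$ is the process solving $d\mathbf{X}_t=\mathbf{b}(\mathbf{X}_t)dt+\bm{\sigma}(\mathbf{X}_t)d\mathbf{W}_t$, $\mathbf{X}_0=\mathbf{x}$, with sufficiently regular coefficients. $\rho$ is a probability distribution on $\mathcal{M}$ (not necessarily stationary), $\mathcal{F}=L^2(\mathcal{M},\rho)$ (real-valued) with inner product $\langle f,g\rangle_\rho=\int_{\mathcal M} fg\,d\rho$ and norm $\|\cdot\|_\rho$. The stochastic Koopman operators are $(\mathcal{K}^tf)(\mathbf{x})=\mathbb{E}[f(\mathbf{X}_t)\mid\mathbf{X}_0=\mathbf{x}]$; it is assumed that $(\mathcal{K}^t)_{t\ge0}$ is a strongly continuous semigroup of bounded linear operators on $\mathcal{F}$. Its generator is $\mathcal{A}f=\lim_{t\to0^+}(\mathcal{K}^tf-f)/t$ (limit in $\mathcal{F}$), with domain $\mathcal{D}(\mathcal{A})$ the set of $f\in\mathcal F$ for which the limit exists. Matrices: $G_{ij}=\langle\psi_i,\psi_j\rangle_\rho$ (invertible) and $H_{ij}=\langle\psi_i,\mathcal{A}\psi_j\rangle_\rho$ ($N\times N$). For i.i.d. samples $\mathbf{x}_1,\mathbf{x}_2,\dots$ from $\rho$, the $m\times N$ data matrices are $(\Psi_X)_{kj}=\psi_j(\mathbf{x}_k)$, $(\Psi'_X)_{kj}=\mathcal{A}\psi_j(\mathbf{x}_k)$, and $\bm{o}_{m,N}(\Delta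 t)$ with entries $o_{k,j}(\Delta t)=\mathcal{K}^{\Delta t}\psi_j(\mathbf{x}_k)-\psi_j(\mathbf{x}_k)-\Delta t\,\mathcal{A}\psi_j(\mathbf{x}_k)$. With $\dagger$ the Moore–Penrose pseudoinverse, $K_{N,\Delta t}=\lim_{m\to\infty}\Psi_X^\dagger(\Psi_X+\Delta t\,\Psi'_X+\bm{o}_{m,N}(\Delta t))$ (almost sure limit, a deterministic matrix); equivalently, $K_{N,\Delta t}=I+\Delta t\,G^{-1}H+\bm{o}_N(\Delta t)$ with $\bm{o}_N(\Delta t)=\lim_{m\to\infty}\Psi_X^\dagger\bm{o}_{m,N}(\Delta t)$, and $K_{N,\Delta t}=G^{-1}\big[\langle\psi_i,\mathcal{K}^{\Delta t}\psi_j\rangle_\rho\big]_{ij}$. Operators: $A_{N,\Delta t}=(K_{N,\Delta t}-I)/\Delta t$, and $\mathcal{A}_{N,\Delta t}:\mathcal{F}_N\to\mathcal{F}_N$ is the linear map $(\psi_1,\dots,\psi_N)\mathbf{a}\mapsto(\psi_1,\dots,\psi_N)A_{N,\Delta t}\mathbf{a}$ for $\mathbf{a}\in\mathbb{R}^N$. $\mathcal{P}_N$ is the orthogonal projection of $\mathcal{F}$ onto $\mathcal{F}_N$, and $\mathcal{A}_N=\mathcal{P}_N\mathcal{A}\mathcal{P}_N$, regarded here as a map $\mathcal{F}_N\to\mathcal{F}_N$. *)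

theory Defs
  imports "HOL-Probability.Probability" "Jordan_Normal_Form.Matrix"
begin

section \<open>The diffusion process\<close>

definition brownian_motion ::
  "'w measure \<Rightarrow> (real \<Rightarrow> 'w measure) \<Rightarrow> (real \<Rightarrow> 'w \<Rightarrow> 'b::euclidean_space) \<Rightarrow> bool" where
  "brownian_motion P Filt W \<longleftrightarrow>
     (\<forall>t\<ge>0. W t \<in> borel_measurable (Filt t)) \<and>
     (\<forall>\<omega>\<in>space P. W 0 \<omega> = 0 \<and> continuous_on {0..} (\<lambda>t. W t \<omega>)) \<and>
     (\<forall>s t. 0 \<le> s \<and> s < t \<longrightarrow>
        prob_space.indep_set P (sets (Filt s))
          {(\<lambda>\<omega>. W t \<omega> - W s \<omega>) -` B \<inter> space P | B. B \<in> sets borel} \<and>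
        distributed P lborel (\<lambda>\<omega>. W t \<omega> - W s \<omega>)
          (\<lambda>z. ennreal (\<Prod>e\<in>Basis. normal_density 0 (sqrt (t - s)) (z \<bullet> e))))"

text \<open>
  \<open>Z\<close> is the Ito integral of \<open>Y\<close> against \<open>W\<close> over \<open>[0, t]\<close>. For continuous adapted integrands,
  the only ones used here, the integral is the limit in probability of the left-endpoint sums.
\<close>

definition has_ito_integral ::
  "'w measure \<Rightarrow> (real \<Rightarrow> 'w \<Rightarrow> 'b::euclidean_space) \<Rightarrow> (real \<Rightarrow> 'w \<Rightarrow> 'b \<Rightarrow>\<^sub>L 'a::euclidean_space)
     \<Rightarrow> real \<Rightarrow> ('w \<Rightarrow> 'a) \<Rightarrow> bool" where
  "has_ito_integral P W Y t Z \<longleftrightarrow>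
     (\<forall>\<epsilon>>0. (\<lambda>n::nat. measure P {\<omega>\<in>space P. \<epsilon> \<le> norm (
         (\<Sum>i<n. blinfun_apply (Y (t * real i / real n) \<omega>)
                   (W (t * real (Suc i) / real n) \<omega> - W (t * real i / real n) \<omega>)) - Z \<omega>)})
       \<longlonglongrightarrow> 0)"

definition solves_sde ::
  "'a::euclidean_space set \<Rightarrow> 'w measure \<Rightarrow> (real \<Rightarrow> 'w measure) \<Rightarrow> (real \<Rightarrow> 'w \<Rightarrow> 'b::euclidean_space)
     \<Rightarrow> ('a \<Rightarrow> 'a) \<Rightarrow> ('a \<Rightarrow> 'b \<Rightarrow>\<^sub>L 'a) \<Rightarrow> 'a \<Rightarrow> (real \<Rightarrow> 'w \<Rightarrow> 'a) \<Rightarrow> bool" where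
  "solves_sde M P Filt W b \<sigma> x X \<longleftrightarrow>
     (\<forall>t\<ge>0. X t \<in> measurable (Filt t) (restrict_space borel M)) \<and>
     (\<forall>\<omega>\<in>space P. X 0 \<omega> = x \<and> continuous_on {0..} (\<lambda>t. X t \<omega>)) \<and>
     (\<forall>t\<ge>0. has_ito_integral P W (\<lambda>s \<omega>. \<sigma> (X s \<omega>)) t
        (\<lambda>\<omega>. X t \<omega> - x - integral {0..t} (\<lambda>s. b (X s \<omega>))))"

text \<open>
  \<open>X x\<close> is the solution started at \<open>x\<close>. Since existence of the solutions is part of the
  assumption, the only regularity asked of the coefficients is continuity, which is what the
  description of the Ito integral above needs.
\<close>

definition diffusion_process ::
  "'a::euclidean_space set \<Rightarrow> 'w measure \<Rightarrow> (real \<Rightarrow> 'w measure) \<Rightarrow> (real \<Rightarrow> 'w \<Rightarrow> 'b::euclidean_space)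
     \<Rightarrow> ('a \<Rightarrow> 'a) \<Rightarrow> ('a \<Rightarrow> 'b \<Rightarrow>\<^sub>L 'a) \<Rightarrow> ('a \<Rightarrow> real \<Rightarrow> 'w \<Rightarrow> 'a) \<Rightarrow> bool" where
  "diffusion_process M P Filt W b \<sigma> X \<longleftrightarrow>
     prob_space P \<and> filtration (space P) Filt \<and> (\<forall>t. sets (Filt t) \<subseteq> sets P) \<and>
     brownian_motion P Filt W \<and> continuous_on M b \<and> continuous_on M \<sigma> \<and>
     (\<forall>x\<in>M. solves_sde M P Filt W b \<sigma> x (X x))"

section \<open>The space \<open>L\<^sup>2(\<rho>)\<close>\<close>

text \<open>
  Elements of \<open>L\<^sup>2(\<rho>)\<close> are handled through representatives: functions whose equality in the
  Hilbert space is \<open>\<rho>\<close>-almost everywhere equality.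
\<close>

definition L2 :: "'a measure \<Rightarrow> ('a \<Rightarrow> real) set" where
  "L2 \<rho> = {f \<in> borel_measurable \<rho>. integrable \<rho> (\<lambda>x. (f x)\<^sup>2)}"

definition l2_inner :: "'a measure \<Rightarrow> ('a \<Rightarrow> real) \<Rightarrow> ('a \<Rightarrow> real) \<Rightarrow> real" where
  "l2_inner \<rho> f g = (\<integral>x. f x * g x \<partial>\<rho>)"

definition l2_norm :: "'a measure \<Rightarrow> ('a \<Rightarrow> real) \<Rightarrow> real" where
  "l2_norm \<rho> f = sqrt (l2_inner \<rho> f f)"

definition L2_bounded_linear ::
  "'a measure \<Rightarrow> (('a \<Rightarrow> real) \<Rightarrow> 'a \<Rightarrow> real) \<Rightarrow> bool" where
  "L2_bounded_linear \<rho> T \<longleftrightarrow>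
     (\<forall>f\<in>L2 \<rho>. T f \<in> L2 \<rho>) \<and>
     (\<forall>f\<in>L2 \<rho>. \<forall>g\<in>L2 \<rho>. \<forall>\<alpha> \<beta>. AE x in \<rho>.
        T (\<lambda>y. \<alpha> * f y + \<beta> * g y) x = \<alpha> * T f x + \<beta> * T g x) \<and>
     (\<exists>B. \<forall>f\<in>L2 \<rho>. l2_norm \<rho> (T f) \<le> B * l2_norm \<rho> f)"

definition L2_C0_semigroup ::
  "'a measure \<Rightarrow> (real \<Rightarrow> ('a \<Rightarrow> real) \<Rightarrow> 'a \<Rightarrow> real) \<Rightarrow> bool" where
  "L2_C0_semigroup \<rho> T \<longleftrightarrow>
     (\<forall>t\<ge>0. L2_bounded_linear \<rho> (T t)) \<and>
     (\<forall>f\<in>L2 \<rho>. AE x in \<rho>. T 0 f x = f x) \<and>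
     (\<forall>s\<ge>0. \<forall>t\<ge>0. \<forall>f\<in>L2 \<rho>. AE x in \<rho>. T (s + t) f x = T s (T t f) x) \<and>
     (\<forall>f\<in>L2 \<rho>. ((\<lambda>t. l2_norm \<rho> (\<lambda>x. T t f x - f x)) \<longlongrightarrow> 0) (at_right 0))"

text \<open>\<open>f\<close> lies in the domain of the generator of \<open>T\<close>, and \<open>g\<close> represents its image.\<close>

definition has_generator ::
  "'a measure \<Rightarrow> (real \<Rightarrow> ('a \<Rightarrow> real) \<Rightarrow> 'a \<Rightarrow> real) \<Rightarrow> ('a \<Rightarrow> real) \<Rightarrow> ('a \<Rightarrow> real) \<Rightarrow> bool" where
  "has_generator \<rho> T f g \<longleftrightarrow> f \<in> L2 \<rho> \<and> g \<in> L2 \<rho> \<and>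
     ((\<lambda>t. l2_norm \<rho> (\<lambda>x. (T t f x - f x) / t - g x)) \<longlongrightarrow> 0) (at_right 0)"

text \<open>The choice of representative is immaterial up to \<open>\<rho>\<close>-null sets.\<close>

definition generator ::
  "'a measure \<Rightarrow> (real \<Rightarrow> ('a \<Rightarrow> real) \<Rightarrow> 'a \<Rightarrow> real) \<Rightarrow> ('a \<Rightarrow> real) \<Rightarrow> 'a \<Rightarrow> real" where
  "generator \<rho> T f = (SOME g. has_generator \<rho> T f g)"

section \<open>Koopman operators\<close>

definition koopman ::
  "'w measure \<Rightarrow> ('a \<Rightarrow> real \<Rightarrow> 'w \<Rightarrow> 'a) \<Rightarrow> real \<Rightarrow> ('a \<Rightarrow> real) \<Rightarrow> 'a \<Rightarrow> real" where
  "koopman P X t f x = (\<integral>\<omega>. f (X x t \<omega>) \<partial>P)"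

text \<open>
  The integrability clause says that the conditional expectation is defined; without it the
  Bochner integral would silently be \<open>0\<close>.
\<close>

definition koopman_semigroup ::
  "'a measure \<Rightarrow> 'w measure \<Rightarrow> ('a \<Rightarrow> real \<Rightarrow> 'w \<Rightarrow> 'a) \<Rightarrow> bool" where
  "koopman_semigroup \<rho> P X \<longleftrightarrow>
     (\<forall>t\<ge>0. \<forall>f\<in>L2 \<rho>. AE x in \<rho>. integrable P (\<lambda>\<omega>. f (X x t \<omega>))) \<and>
     L2_C0_semigroup \<rho> (koopman P X)"

section \<open>The dictionary space\<close>

definition dict_comb :: "nat \<Rightarrow> (nat \<Rightarrow> 'a \<Rightarrow> real) \<Rightarrow> real vec \<Rightarrow> 'a \<Rightarrow> real" where
  "dict_comb N \<psi> a = (\<lambda>x. \<Sum>i<N. \<psi> i x * vec_index a i)"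

definition dict_span :: "nat \<Rightarrow> (nat \<Rightarrow> 'a \<Rightarrow> real) \<Rightarrow> ('a \<Rightarrow> real) set" where
  "dict_span N \<psi> = dict_comb N \<psi> ` carrier_vec N"

text \<open>
  Independence is in \<open>L\<^sup>2(\<rho>)\<close>. It makes every class in the span of the dictionary have exactly one
  representative in \<open>dict_span N \<psi>\<close>, and every element of \<open>dict_span N \<psi>\<close> exactly one coefficient
  vector, so the definite descriptions below denote.
\<close>

definition dict_independent :: "'a measure \<Rightarrow> nat \<Rightarrow> (nat \<Rightarrow> 'a \<Rightarrow> real) \<Rightarrow> bool" where
  "dict_independent \<rho> N \<psi> \<longleftrightarrow>
     (\<forall>a\<in>carrier_vec N. (AE x in \<rho>. dict_comb N \<psi> a x = 0) \<longrightarrow> a = 0\<^sub>v N)"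

definition dict_coeffs :: "nat \<Rightarrow> (nat \<Rightarrow> 'a \<Rightarrow> real) \<Rightarrow> ('a \<Rightarrow> real) \<Rightarrow> real vec" where
  "dict_coeffs N \<psi> f = (THE a. a \<in> carrier_vec N \<and> dict_comb N \<psi> a = f)"

definition dict_proj :: "'a measure \<Rightarrow> nat \<Rightarrow> (nat \<Rightarrow> 'a \<Rightarrow> real) \<Rightarrow> ('a \<Rightarrow> real) \<Rightarrow> 'a \<Rightarrow> real" where
  "dict_proj \<rho> N \<psi> f = (THE g. g \<in> dict_span N \<psi> \<and>
     (\<forall>h\<in>dict_span N \<psi>. l2_inner \<rho> (\<lambda>x. f x - g x) h = 0))"

definition dict_opnorm ::
  "'a measure \<Rightarrow> nat \<Rightarrow> (nat \<Rightarrow> 'a \<Rightarrow> real) \<Rightarrow> (('a \<Rightarrow> real) \<Rightarrow> 'a \<Rightarrow> real) \<Rightarrow> real" where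
  "dict_opnorm \<rho> N \<psi> T = (SUP f\<in>{f \<in> dict_span N \<psi>. l2_norm \<rho> f \<le> 1}. l2_norm \<rho> (T f))"

definition compressed_generator ::
  "'a measure \<Rightarrow> (real \<Rightarrow> ('a \<Rightarrow> real) \<Rightarrow> 'a \<Rightarrow> real) \<Rightarrow> nat \<Rightarrow> (nat \<Rightarrow> 'a \<Rightarrow> real)
     \<Rightarrow> ('a \<Rightarrow> real) \<Rightarrow> 'a \<Rightarrow> real" where
  "compressed_generator \<rho> T N \<psi> f = dict_proj \<rho> N \<psi> (generator \<rho> T (dict_proj \<rho> N \<psi> f))"

section \<open>Data matrices and the limiting data-driven operator\<close>

text \<open>Moore-Penrose pseudoinverse, as the solution of the four Penrose equations.\<close>

definition pinv :: "real mat \<Rightarrow> real mat" where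
  "pinv A = (THE B. B \<in> carrier_mat (dim_col A) (dim_row A) \<and>
     A * B * A = A \<and> B * A * B = B \<and>
     transpose_mat (A * B) = A * B \<and> transpose_mat (B * A) = B * A)"

definition data_matrix :: "nat \<Rightarrow> nat \<Rightarrow> (nat \<Rightarrow> 'a \<Rightarrow> real) \<Rightarrow> (nat \<Rightarrow> 'a) \<Rightarrow> real mat" where
  "data_matrix m N \<phi> x = Matrix.mat m N (\<lambda>(k, j). \<phi> j (x k))"

text \<open>
  Below \<open>\<phi> j\<close> is the chosen representative of the generator applied to \<open>\<psi> j\<close>, and \<open>x\<close> is the
  sequence of sampled points, counted from \<open>0\<close>.
\<close>

definition remainder_matrix ::
  "(real \<Rightarrow> ('a \<Rightarrow> real) \<Rightarrow> 'a \<Rightarrow> real) \<Rightarrow> nat \<Rightarrow> nat \<Rightarrow> (nat \<Rightarrow> 'a \<Rightarrow> real) \<Rightarrow> (nat \<Rightarrow> 'a \<Rightarrow> real)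
     \<Rightarrow> real \<Rightarrow> (nat \<Rightarrow> 'a) \<Rightarrow> real mat" where
  "remainder_matrix T m N \<psi> \<phi> \<Delta>t x =
     data_matrix m N (\<lambda>j y. T \<Delta>t (\<psi> j) y - \<psi> j y - \<Delta>t * \<phi> j y) x"

definition edmd_matrix ::
  "(real \<Rightarrow> ('a \<Rightarrow> real) \<Rightarrow> 'a \<Rightarrow> real) \<Rightarrow> nat \<Rightarrow> nat \<Rightarrow> (nat \<Rightarrow> 'a \<Rightarrow> real) \<Rightarrow> (nat \<Rightarrow> 'a \<Rightarrow> real)
     \<Rightarrow> real \<Rightarrow> (nat \<Rightarrow> 'a) \<Rightarrow> real mat" where
  "edmd_matrix T m N \<psi> \<phi> \<Delta>t x =
     pinv (data_matrix m N \<psi> x) *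
       (data_matrix m N \<psi> x + \<Delta>t \<cdot>\<^sub>m data_matrix m N \<phi> x + remainder_matrix T m N \<psi> \<phi> \<Delta>t x)"

definition iid_samples :: "'s measure \<Rightarrow> 'a measure \<Rightarrow> (nat \<Rightarrow> 's \<Rightarrow> 'a) \<Rightarrow> bool" where
  "iid_samples S \<rho> \<xi> \<longleftrightarrow> prob_space S \<and> prob_space.indep_vars S (\<lambda>_. \<rho>) \<xi> UNIV \<and>
     (\<forall>k. distr S \<rho> (\<xi> k) = \<rho>)"

text \<open>The deterministic matrix that is the almost sure limit for infinitely many samples.\<close>

definition limit_matrix ::
  "'s measure \<Rightarrow> (nat \<Rightarrow> 's \<Rightarrow> 'a) \<Rightarrow> (real \<Rightarrow> ('a \<Rightarrow> real) \<Rightarrow> 'a \<Rightarrow> real) \<Rightarrow> nat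
     \<Rightarrow> (nat \<Rightarrow> 'a \<Rightarrow> real) \<Rightarrow> (nat \<Rightarrow> 'a \<Rightarrow> real) \<Rightarrow> real \<Rightarrow> real mat" where
  "limit_matrix S \<xi> T N \<psi> \<phi> \<Delta>t = (THE K. K \<in> carrier_mat N N \<and>
     (AE s in S. \<forall>i<N. \<forall>j<N.
        (\<lambda>m. edmd_matrix T m N \<psi> \<phi> \<Delta>t (\<lambda>k. \<xi> k s) $$ (i, j)) \<longlonglongrightarrow> K $$ (i, j)))"

definition generator_matrix ::
  "'s measure \<Rightarrow> (nat \<Rightarrow> 's \<Rightarrow> 'a) \<Rightarrow> (real \<Rightarrow> ('a \<Rightarrow> real) \<Rightarrow> 'a \<Rightarrow> real) \<Rightarrow> nat
     \<Rightarrow> (nat \<Rightarrow> 'a \<Rightarrow> real) \<Rightarrow> (nat \<Rightarrow> 'a \<Rightarrow> real) \<Rightarrow> real \<Rightarrow> real mat" where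
  "generator_matrix S \<xi> T N \<psi> \<phi> \<Delta>t =
     (1 / \<Delta>t) \<cdot>\<^sub>m (limit_matrix S \<xi> T N \<psi> \<phi> \<Delta>t - 1\<^sub>m N)"

definition data_driven_generator ::
  "'s measure \<Rightarrow> (nat \<Rightarrow> 's \<Rightarrow> 'a) \<Rightarrow> (real \<Rightarrow> ('a \<Rightarrow> real) \<Rightarrow> 'a \<Rightarrow> real) \<Rightarrow> nat
     \<Rightarrow> (nat \<Rightarrow> 'a \<Rightarrow> real) \<Rightarrow> (nat \<Rightarrow> 'a \<Rightarrow> real) \<Rightarrow> real
     \<Rightarrow> ('a \<Rightarrow> real) \<Rightarrow> 'a \<Rightarrow> real" where
  "data_driven_generator S \<xi> T N \<psi> \<phi> \<Delta>t f =
     dict_comb N \<psi> (generator_matrix S \<xi> T N \<psi> \<phi> \<Delta>t *\<^sub>v dict_coeffs N \<psi> f)"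

end

theory Submission
  imports Defs "Jordan_Normal_Form.Determinant" "HOL-Library.Discrete_Functions"
begin

text \<open>
  Once the empirical Gram matrix is invertible, the data matrix has full column rank, and the EDMD
  matrix is the inverse empirical Gram matrix times the matrix of empirical averages of
  \<open>\<psi>\<^sub>i \<cdot> K\<^sup>t \<psi>\<^sub>j\<close>. Since the dictionary is almost surely bounded on the samples, these averages are
  over square-integrable variables, and the strong law of large numbers identifies the limit as
  \<open>G\<inverse> \<langle>\<psi>\<^sub>i, K\<^sup>t \<psi>\<^sub>j\<rangle>\<close>. Hence the coefficient matrix of the data-driven generator is
  \<open>G\<inverse> \<langle>\<psi>\<^sub>i, (K\<^sup>t \<psi>\<^sub>j - \<psi>\<^sub>j) / t\<rangle>\<close>, which tends entrywise to the matrix \<open>G\<inverse> H\<close> of the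
  compressed generator; on a finite-dimensional space this is convergence in operator norm.
\<close>

section \<open>Square-integrable functions\<close>

lemma L2_measurable: "f \<in> L2 M \<Longrightarrow> f \<in> borel_measurable M"
  by (simp add: L2_def)

lemma L2_mult_integrable:
  assumes f: "f \<in> L2 M" and g: "g \<in> L2 M"
  shows "integrable M (\<lambda>x. f x * g x)"
proof (rule Bochner_Integration.integrable_bound)
  show "integrable M (\<lambda>x. (f x)\<^sup>2 + (g x)\<^sup>2)"
    using f g by (simp add: L2_def)
  show "(\<lambda>x. f x * g x) \<in> borel_measurable M"
    using f g by (intro borel_measurable_times L2_measurable)
  have "\<bar>u * v\<bar> \<le> u\<^sup>2 + v\<^sup>2" for u v :: real
  proof -
    have "2 * (\<bar>u\<bar> * \<bar>v\<bar>) \<le> u\<^sup>2 + v\<^sup>2"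
      using sum_squares_bound[of "\<bar>u\<bar>" "\<bar>v\<bar>"] by simp
    moreover have "0 \<le> \<bar>u\<bar> * \<bar>v\<bar>" by simp
    ultimately show ?thesis unfolding abs_mult by linarith
  qed
  then show "AE x in M. norm (f x * g x) \<le> norm ((f x)\<^sup>2 + (g x)\<^sup>2)"
    by simp
qed

lemma L2_add:
  assumes f: "f \<in> L2 M" and g: "g \<in> L2 M"
  shows "(\<lambda>x. f x + g x) \<in> L2 M"
proof -
  have "integrable M (\<lambda>x. (f x)\<^sup>2 + (g x)\<^sup>2 + 2 * (f x * g x))"
    using f g L2_mult_integrable[OF f g] by (simp add: L2_def)
  moreover have "(\<lambda>x. f x + g x) \<in> borel_measurable M"
    using f g by (intro borel_measurable_add L2_measurable)
  ultimately show ?thesis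
    by (simp add: L2_def power2_sum mult.assoc)
qed

lemma L2_mult_right: "f \<in> L2 M \<Longrightarrow> (\<lambda>x. f x * c) \<in> L2 M"
  by (auto simp: L2_def power_mult_distrib intro!: borel_measurable_times)

lemma L2_zero: "(\<lambda>x. 0) \<in> L2 M"
  by (simp add: L2_def)

lemma L2_divide: "f \<in> L2 M \<Longrightarrow> (\<lambda>x. f x / c) \<in> L2 M"
  using L2_mult_right[of f M "1 / c"] by simp

lemma L2_diff:
  assumes "f \<in> L2 M" "g \<in> L2 M"
  shows "(\<lambda>x. f x - g x) \<in> L2 M"
  using L2_add[OF assms(1) L2_mult_right[OF assms(2), of "-1"]] by simp

lemma L2_sum:
  assumes "\<And>i. i \<in> I \<Longrightarrow> f i \<in> L2 M"
  shows "(\<lambda>x. \<Sum>i\<in>I. f i x * c i) \<in> L2 M"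
  using assms
  by (induction I rule: infinite_finite_induct) (auto simp: L2_zero intro!: L2_add L2_mult_right)

section \<open>Algebra of the inner product and the norm, up to Cauchy-Schwarz and the triangle
  inequality\<close>

lemma l2_inner_commute: "l2_inner M f g = l2_inner M g f"
  by (simp add: l2_inner_def mult.commute)

lemma l2_inner_nonneg: "0 \<le> l2_inner M f f"
  by (simp add: l2_inner_def)

lemma l2_norm_nonneg: "0 \<le> l2_norm M f"
  by (simp add: l2_norm_def l2_inner_nonneg)

lemma l2_norm_power2: "(l2_norm M f)\<^sup>2 = l2_inner M f f"
  by (simp add: l2_norm_def l2_inner_nonneg)

lemma l2_inner_mult_right: "l2_inner M f (\<lambda>x. g x * c) = l2_inner M f g * c"
  by (simp add: l2_inner_def flip: mult.assoc)

lemma l2_inner_divide_right: "l2_inner M f (\<lambda>x. g x / c) = l2_inner M f g / c"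
  using l2_inner_mult_right[of M f g "1 / c"] by simp

lemma l2_inner_diff_right:
  assumes "f \<in> L2 M" "g \<in> L2 M" "h \<in> L2 M"
  shows "l2_inner M f (\<lambda>x. g x - h x) = l2_inner M f g - l2_inner M f h"
  using assms by (simp add: l2_inner_def algebra_simps L2_mult_integrable)

lemma l2_inner_sum_right:
  assumes "f \<in> L2 M" "\<And>i. i \<in> I \<Longrightarrow> g i \<in> L2 M"
  shows "l2_inner M f (\<lambda>x. \<Sum>i\<in>I. g i x * c i) = (\<Sum>i\<in>I. l2_inner M f (g i) * c i)"
proof -
  have "l2_inner M f (\<lambda>x. \<Sum>i\<in>I. g i x * c i) = (\<integral>x. (\<Sum>i\<in>I. f x * g i x * c i) \<partial>M)"
    by (simp add: l2_inner_def sum_distrib_left mult.assoc)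
  also have "\<dots> = (\<Sum>i\<in>I. l2_inner M f (g i) * c i)"
    using assms by (subst Bochner_Integration.integral_sum) (auto simp: l2_inner_def L2_mult_integrable)
  finally show ?thesis .
qed

lemma l2_norm_cong_AE:
  assumes "f \<in> borel_measurable M" "g \<in> borel_measurable M" "AE x in M. f x = g x"
  shows "l2_norm M f = l2_norm M g"
proof -
  have "(\<integral>x. f x * f x \<partial>M) = (\<integral>x. g x * g x \<partial>M)"
    by (rule integral_cong_AE) (use assms in auto)
  then show ?thesis by (simp add: l2_norm_def l2_inner_def)
qed

lemma l2_inner_self_eq_0:
  assumes "f \<in> L2 M"
  shows "l2_inner M f f = 0 \<longleftrightarrow> (AE x in M. f x = 0)"
  using integral_nonneg_eq_0_iff_AE[OF L2_mult_integrable[OF assms assms]]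
  by (simp add: l2_inner_def)

text \<open>Expansion of the integral of \<open>(u * f x + v * g x)^2\<close>. Positivity of this
  quadratic form in \<open>u\<close> and \<open>v\<close> is the whole input to
  Cauchy-Schwarz.\<close>

lemma l2_inner_combination:
  assumes f: "f \<in> L2 M" and g: "g \<in> L2 M"
  shows "0 \<le> u\<^sup>2 * l2_inner M f f + 2 * u * v * l2_inner M f g + v\<^sup>2 * l2_inner M g g"
proof -
  have "0 \<le> (\<integral>x. (u * f x + v * g x)\<^sup>2 \<partial>M)" by simp
  also have "(\<lambda>x. (u * f x + v * g x)\<^sup>2)
      = (\<lambda>x. u\<^sup>2 * (f x * f x) + 2 * u * v * (f x * g x) + v\<^sup>2 * (g x * g x))"
    by (simp add: power2_eq_square algebra_simps)
  finally show ?thesis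
    using L2_mult_integrable[OF f g] L2_mult_integrable[OF f f] L2_mult_integrable[OF g g]
    by (simp add: l2_inner_def)
qed

lemma l2_Cauchy_Schwarz:
  assumes f: "f \<in> L2 M" and g: "g \<in> L2 M"
  shows "\<bar>l2_inner M f g\<bar> \<le> l2_norm M f * l2_norm M g"
proof -
  define a b c where "a = l2_inner M f f" and "b = l2_inner M f g" and "c = l2_inner M g g"
  have ac: "a \<ge> 0" "c \<ge> 0" by (simp_all add: a_def c_def l2_inner_nonneg)
  have q: "0 \<le> u\<^sup>2 * a + 2 * u * v * b + v\<^sup>2 * c" for u v
    using l2_inner_combination[OF f g] by (simp add: a_def b_def c_def)
  have "b\<^sup>2 \<le> a * c"
  proof (cases "a = 0 \<and> c = 0")
    case True
    \<comment> \<open>Only the cross term survives here, and the two signs of \<open>v\<close> force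
      \<open>b = 0\<close>.\<close>
    then show ?thesis using q[of 1 1] q[of 1 "-1"] by simp
  next
    case False
    \<comment> \<open>The choices \<open>(u, v) = (c, - b)\<close> and \<open>(- b, a)\<close> each
      make the form a multiple of \<open>a * c - b^2\<close>, with factors \<open>c\<close> and
      \<open>a\<close>. At least one factor is positive and can be cancelled.\<close>
    have "0 \<le> c * (a * c - b\<^sup>2)" "0 \<le> a * (a * c - b\<^sup>2)"
      using q[of c "- b"] q[of "- b" a] by (simp_all add: power2_eq_square algebra_simps)
    then show ?thesis
      using False ac by (auto simp: zero_le_mult_iff)
  qed
  then have "\<bar>b\<bar> \<le> sqrt (a * c)"
    using real_le_rsqrt[of "\<bar>b\<bar>" "a * c"] by simp
  then show ?thesis
    by (simp add: a_def b_def c_def l2_norm_def real_sqrt_mult)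
qed

lemma l2_norm_triangle:
  assumes f: "f \<in> L2 M" and g: "g \<in> L2 M"
  shows "l2_norm M (\<lambda>x. f x + g x) \<le> l2_norm M f + l2_norm M g"
proof (rule power2_le_imp_le)
  have "(l2_norm M (\<lambda>x. f x + g x))\<^sup>2
      = (\<integral>x. f x * f x + 2 * (f x * g x) + g x * g x \<partial>M)"
    by (simp add: l2_norm_power2 l2_inner_def algebra_simps)
  also have "\<dots> = l2_inner M f f + 2 * l2_inner M f g + l2_inner M g g"
    using L2_mult_integrable[OF f g] L2_mult_integrable[OF f f] L2_mult_integrable[OF g g]
    by (simp add: l2_inner_def)
  also have "\<dots> \<le> (l2_norm M f)\<^sup>2 + 2 * (l2_norm M f * l2_norm M g) + (l2_norm M g)\<^sup>2"
    using l2_Cauchy_Schwarz[OF f g] by (simp add: l2_norm_power2)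
  finally show "(l2_norm M (\<lambda>x. f x + g x))\<^sup>2 \<le> (l2_norm M f + l2_norm M g)\<^sup>2"
    by (simp add: power2_sum)
qed (simp add: l2_norm_nonneg)

lemma l2_norm_mult_right: "l2_norm M (\<lambda>x. f x * c) = l2_norm M f * \<bar>c\<bar>"
proof -
  have "l2_inner M (\<lambda>x. f x * c) (\<lambda>x. f x * c) = l2_inner M f f * c\<^sup>2"
    by (simp add: l2_inner_mult_right l2_inner_commute[of M "\<lambda>x. f x * c"] power2_eq_square)
  then show ?thesis by (simp add: l2_norm_def real_sqrt_mult)
qed

lemma l2_norm_sum_le:
  assumes "\<And>i. i \<in> I \<Longrightarrow> f i \<in> L2 M"
  shows "l2_norm M (\<lambda>x. \<Sum>i\<in>I. f i x * c i) \<le> (\<Sum>i\<in>I. l2_norm M (f i) * \<bar>c i\<bar>)"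
  using assms
proof (induction I rule: infinite_finite_induct)
  case (insert i I)
  have "l2_norm M (\<lambda>x. f i x * c i + (\<Sum>i\<in>I. f i x * c i))
      \<le> l2_norm M (\<lambda>x. f i x * c i) + l2_norm M (\<lambda>x. \<Sum>i\<in>I. f i x * c i)"
    using insert.prems by (intro l2_norm_triangle L2_mult_right L2_sum) auto
  then show ?case
    using insert by (simp add: l2_norm_mult_right)
qed (simp_all add: l2_norm_def l2_inner_def)

section \<open>A strong law of large numbers\<close>

text \<open>The integral of the pointwise series equals the sum of the integrals, which is finite.
  So the series converges almost everywhere and its terms vanish in the limit. This takes the place
  of a Borel-Cantelli argument.\<close>

lemma AE_tendsto_0_if_summable_integral:
  fixes f :: "nat \<Rightarrow> 'a \<Rightarrow> real"
  assumes int: "\<And>n. integrable M (f n)"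
    and nonneg: "\<And>n x. 0 \<le> f n x"
    and sm: "summable (\<lambda>n. \<integral>x. f n x \<partial>M)"
  shows "AE x in M. (\<lambda>n. f n x) \<longlonglongrightarrow> 0"
proof -
  have [measurable]: "f n \<in> borel_measurable M" for n
    using int by blast
  have "(\<integral>\<^sup>+x. (\<Sum>n. ennreal (f n x)) \<partial>M) = (\<Sum>n. \<integral>\<^sup>+x. ennreal (f n x) \<partial>M)"
    by (intro nn_integral_suminf) measurable
  also have "\<dots> = (\<Sum>n. ennreal (\<integral>x. f n x \<partial>M))"
    using int nonneg by (simp add: nn_integral_eq_integral)
  also have "\<dots> = ennreal (\<Sum>n. \<integral>x. f n x \<partial>M)"
    using sm nonneg by (intro suminf_ennreal2) auto
  finally have "AE x in M. (\<Sum>n. ennreal (f n x)) \<noteq> \<infinity>"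
    by (intro nn_integral_PInf_AE) auto
  then show ?thesis
  proof eventually_elim
    case (elim x)
    then have "summable (\<lambda>n. f n x)"
      using nonneg by (intro summable_suminf_not_top) auto
    then show ?case by (rule summable_LIMSEQ_zero)
  qed
qed

text \<open>
  Along the squares the second moments of the averages are summable; between \<open>n\<^sup>2\<close> and \<open>(n+1)\<^sup>2\<close> the
  maximal oscillation of the partial sums is bounded by the sum of all block sums squared.
\<close>

lemma AE_orthogonal_averages_tendsto_0:
  fixes Z :: "nat \<Rightarrow> 'a \<Rightarrow> real"
  assumes L2: "\<And>k. Z k \<in> L2 M"
    and orth: "\<And>j k. j \<noteq> k \<Longrightarrow> l2_inner M (Z j) (Z k) = 0"
    and var: "\<And>k. l2_inner M (Z k) (Z k) \<le> v"
  shows "AE x in M. (\<lambda>m. (\<Sum>k<m. Z k x) / m) \<longlonglongrightarrow> 0"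
proof -
  have v: "0 \<le> v" using var[of 0] l2_inner_nonneg[of M "Z 0"] by linarith
  have sum_L2: "(\<lambda>x. \<Sum>k\<in>A. Z k x) \<in> L2 M" for A
    using L2_sum[of A Z M "\<lambda>_. 1"] L2 by simp
  have int: "integrable M (\<lambda>x. (\<Sum>k\<in>A. Z k x)\<^sup>2)" for A
    using sum_L2[of A] by (simp add: L2_def)
  \<comment> \<open>Orthogonality removes the cross terms of the squared sum, so second moments of
    block sums grow only linearly in the block length.\<close>
  have block: "(\<integral>x. (\<Sum>k\<in>A. Z k x)\<^sup>2 \<partial>M) \<le> card A * v" if "finite A" for A
  proof -
    have "(\<integral>x. (\<Sum>k\<in>A. Z k x)\<^sup>2 \<partial>M) = (\<integral>x. (\<Sum>j\<in>A. \<Sum>k\<in>A. Z j x * Z k x) \<partial>M)"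
      by (simp add: power2_eq_square sum_product)
    also have "\<dots> = (\<Sum>j\<in>A. \<Sum>k\<in>A. l2_inner M (Z j) (Z k))"
      using L2 by (simp add: l2_inner_def L2_mult_integrable)
    also have "\<dots> = (\<Sum>j\<in>A. \<Sum>k\<in>A. if j = k then l2_inner M (Z j) (Z j) else 0)"
      by (intro sum.cong) (auto simp: orth)
    also have "\<dots> = (\<Sum>j\<in>A. l2_inner M (Z j) (Z j))"
      using that by simp
    also have "\<dots> \<le> card A * v"
      using sum_bounded_above[of A "\<lambda>j. l2_inner M (Z j) (Z j)" v] var by simp
    finally show ?thesis .
  qed
  \<comment> \<open>Every \<open>m\<close> with \<open>n^2 <= m < (n+1)^2\<close> is
    \<open>n^2 + j\<close> with \<open>j <= 2 * n\<close>, whence the range of \<open>j\<close>.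
    Summing over all \<open>j\<close> is a crude substitute for the maximum over
    \<open>j\<close>.\<close>
  define D where "D n x = (\<Sum>k<n\<^sup>2. Z k x)\<^sup>2 + (\<Sum>j<2*n+1. (\<Sum>k\<in>{n\<^sup>2..<n\<^sup>2+j}. Z k x)\<^sup>2)"
    for n :: nat and x
  \<comment> \<open>\<open>n ^ 4\<close> is the square of the normalisation at the index
    \<open>n^2\<close>.\<close>
  define f where "f n x = D n x / real n ^ 4" for n x
  have D_nonneg: "0 \<le> D n x" for n x
    by (auto simp: D_def intro!: add_nonneg_nonneg sum_nonneg)
  have D_int: "integrable M (D n)" for n
    unfolding D_def by (intro Bochner_Integration.integrable_add Bochner_Integration.integrable_sum int)
  have D_le: "(\<integral>x. D n x \<partial>M) \<le> real n ^ 2 * v + (2 * n + 1) * ((2 * n) * v)" for n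
  proof -
    have "(\<integral>x. D n x \<partial>M) = (\<integral>x. (\<Sum>k<n\<^sup>2. Z k x)\<^sup>2 \<partial>M)
        + (\<Sum>j<2*n+1. (\<integral>x. (\<Sum>k\<in>{n\<^sup>2..<n\<^sup>2+j}. Z k x)\<^sup>2 \<partial>M))"
      unfolding D_def by (simp add: int del: sum.lessThan_Suc)
    also have "\<dots> \<le> real n ^ 2 * v + (\<Sum>j<2*n+1. real (2 * n) * v)"
    proof (intro add_mono sum_mono)
      show "(\<integral>x. (\<Sum>k<n\<^sup>2. Z k x)\<^sup>2 \<partial>M) \<le> real n ^ 2 * v"
        using block[of "{..<n\<^sup>2}"] by simp
      fix j assume "j \<in> {..<2*n+1}"
      then have "real j * v \<le> real (2 * n) * v"
        using v by (intro mult_right_mono) auto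
      then show "(\<integral>x. (\<Sum>k\<in>{n\<^sup>2..<n\<^sup>2+j}. Z k x)\<^sup>2 \<partial>M) \<le> real (2 * n) * v"
        using block[of "{n\<^sup>2..<n\<^sup>2+j}"] by simp
    qed
    finally show ?thesis by (simp add: algebra_simps)
  qed
  \<comment> \<open>The constant comes from \<open>n^2 + (2n+1) * 2n = 5n^2 + 2n <= 7n^2\<close>. At
    \<open>n = 0\<close> both sides are 0 because division by zero gives 0.\<close>
  have f_le: "(\<integral>x. f n x \<partial>M) \<le> 7 * v * inverse (real n ^ 2)" for n
  proof (cases "n = 0")
    case False
    have "real n \<le> real n ^ 2"
      using False by (simp add: power2_eq_square)
    then have "real n ^ 2 + (2 * n + 1) * (2 * n) \<le> 7 * real n ^ 2"
      by (simp add: power2_eq_square algebra_simps)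
    then have "(real n ^ 2 + (2 * n + 1) * (2 * n)) * v \<le> 7 * real n ^ 2 * v"
      using v by (intro mult_right_mono) auto
    with D_le[of n] have "(\<integral>x. D n x \<partial>M) \<le> 7 * real n ^ 2 * v"
      by (simp add: algebra_simps)
    then have "(\<integral>x. D n x \<partial>M) / real n ^ 4 \<le> 7 * real n ^ 2 * v / real n ^ 4"
      by (intro divide_right_mono) auto
    also have "\<dots> = 7 * v * inverse (real n ^ 2)"
      using False by (simp add: field_simps power4_eq_xxxx power2_eq_square)
    finally show ?thesis by (simp add: f_def)
  qed (simp add: f_def)
  have "AE x in M. (\<lambda>n. f n x) \<longlonglongrightarrow> 0"
  proof (rule AE_tendsto_0_if_summable_integral)
    show "integrable M (f n)" for n
      unfolding f_def by (simp add: D_int)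
    show "0 \<le> f n x" for n x
      by (simp add: f_def D_nonneg)
    show "summable (\<lambda>n. \<integral>x. f n x \<partial>M)"
    proof (rule summable_comparison_test')
      show "summable (\<lambda>n. 7 * v * inverse (real n ^ 2))"
        by (intro summable_mult inverse_power_summable) simp
      show "norm (\<integral>x. f n x \<partial>M) \<le> 7 * v * inverse (real n ^ 2)" for n
        using f_le[of n] by (simp add: integral_nonneg f_def D_nonneg)
    qed
  qed
  then show ?thesis
  proof eventually_elim
    case (elim x)
    \<comment> \<open>Each \<open>m\<close> is compared with the largest square not exceeding it, so
      the limit along squares is pulled back along \<open>floor_sqrt\<close>.\<close>
    have "filterlim floor_sqrt at_top at_top"
      unfolding filterlim_at_top
    proof
      fix n
      show "\<forall>\<^sub>F m in at_top. n \<le> floor_sqrt m"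
        using eventually_ge_at_top[of "n\<^sup>2"]
        by eventually_elim (metis floor_sqrt_inverse_power2 mono_floor_sqrt')
    qed
    with elim have lim: "(\<lambda>m. 2 * f (floor_sqrt m) x) \<longlonglongrightarrow> 0"
      by (intro tendsto_mult_right_zero) (rule filterlim_compose)
    have "(\<lambda>m. ((\<Sum>k<m. Z k x) / m)\<^sup>2) \<longlonglongrightarrow> 0"
    proof (rule Lim_null_comparison[OF _ lim])
      show "\<forall>\<^sub>F m in at_top. norm (((\<Sum>k<m. Z k x) / real m)\<^sup>2) \<le> 2 * f (floor_sqrt m) x"
        \<comment> \<open>\<open>m > 0\<close> ensures \<open>floor_sqrt m > 0\<close>, so that
          dividing by its fourth power is genuine.\<close>
        using eventually_gt_at_top[of 0]
      proof eventually_elim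
        case (elim m)
        define n where "n = floor_sqrt m"
        have n: "n > 0" "n\<^sup>2 \<le> m" "m < (Suc n)\<^sup>2"
          using elim Suc_floor_sqrt_power2_gt[of m] by (simp_all add: n_def)
        define j where "j = m - n\<^sup>2"
        have j: "m = n\<^sup>2 + j" "j < 2 * n + 1"
          using n by (auto simp: j_def power2_eq_square)
        define s t where "s = (\<Sum>k<n\<^sup>2. Z k x)" and "t = (\<Sum>k\<in>{n\<^sup>2..<n\<^sup>2+j}. Z k x)"
        have "{..<m} = {..<n\<^sup>2} \<union> {n\<^sup>2..<n\<^sup>2+j}" using j by auto
        then have "(\<Sum>k<m. Z k x) = s + t"
          unfolding s_def t_def by (simp add: sum.union_disjoint ivl_disj_int)
        moreover have "(s + t)\<^sup>2 \<le> 2 * (s\<^sup>2 + t\<^sup>2)"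
          using sum_squares_bound[of s t] by (simp add: power2_sum)
        \<comment> \<open>The squared tail is one of the nonnegative summands in the second part of
          \<open>D n x\<close>.\<close>
        moreover have "t\<^sup>2 \<le> (\<Sum>j<2*n+1. (\<Sum>k\<in>{n\<^sup>2..<n\<^sup>2+j}. Z k x)\<^sup>2)"
          unfolding t_def using j
          by (intro member_le_sum[of j _ "\<lambda>j. (\<Sum>k\<in>{n\<^sup>2..<n\<^sup>2+j}. Z k x)\<^sup>2"]) auto
        ultimately have le: "(\<Sum>k<m. Z k x)\<^sup>2 \<le> 2 * D n x"
          by (simp add: D_def s_def)
        have "real (n\<^sup>2) \<le> real m" using n by (simp only: of_nat_le_iff)
        then have "real n ^ 4 \<le> (real m)\<^sup>2"
          using power_mono[of "real (n\<^sup>2)" "real m" 2] by simp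
        with le have "(\<Sum>k<m. Z k x)\<^sup>2 / (real m)\<^sup>2 \<le> 2 * D n x / real n ^ 4"
          using n D_nonneg[of n x] by (intro frac_le) auto
        then show ?case by (simp add: f_def n_def power_divide)
      qed
    qed
    \<comment> \<open>Convergence of the squares passes to absolute values through the square root,
      and from there to the averages themselves.\<close>
    then have "(\<lambda>m. sqrt (((\<Sum>k<m. Z k x) / m)\<^sup>2)) \<longlonglongrightarrow> sqrt 0"
      by (rule tendsto_real_sqrt)
    then show ?case
      by (simp only: real_sqrt_abs real_sqrt_zero tendsto_rabs_zero_iff)
  qed
qed

text \<open>After centring, the variables \<open>g (\<xi> k s)\<close> are independent with mean
  zero, hence pairwise orthogonal, and they share one second moment, finite because \<open>h\<close>
  is square-integrable. The result on orthogonal averages then applies.\<close>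

lemma iid_samples_strong_law:
  assumes samples: "iid_samples S \<rho> \<xi>" and h: "h \<in> L2 \<rho>"
  shows "AE s in S. (\<lambda>m. (\<Sum>k<m. h (\<xi> k s)) / m) \<longlonglongrightarrow> (\<integral>x. h x \<partial>\<rho>)"
proof -
  interpret S: prob_space S using samples by (simp add: iid_samples_def)
  have iv: "S.indep_vars (\<lambda>_. \<rho>) \<xi> UNIV" and distr: "distr S \<rho> (\<xi> k) = \<rho>" for k
    using samples by (auto simp: iid_samples_def)
  have \<xi>[measurable]: "\<xi> k \<in> measurable S \<rho>" for k
    using iv by (auto simp: S.indep_vars_def)
  interpret \<rho>: prob_space \<rho>
    using S.prob_space_distr[OF \<xi>[of 0]] by (simp add: distr)
  have h_meas[measurable]: "h \<in> borel_measurable \<rho>" and h2: "integrable \<rho> (\<lambda>x. (h x)\<^sup>2)"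
    using h by (auto simp: L2_def)
  define \<mu> where "\<mu> = (\<integral>x. h x \<partial>\<rho>)"
  define g where "g x = h x - \<mu>" for x
  have h_int: "integrable \<rho> h"
    using \<rho>.square_integrable_imp_integrable[OF h_meas h2] .
  have const: "(\<lambda>x. \<mu>) \<in> L2 \<rho>" by (simp add: L2_def)
  have g: "g \<in> L2 \<rho>" unfolding g_def by (rule L2_diff[OF h const])
  then have g_meas[measurable]: "g \<in> borel_measurable \<rho>" by (rule L2_measurable)
  \<comment> \<open>All samples have law \<rho>, so integrals of functions of a sample are integrals
    over \<rho>, whatever the index \<open>k\<close>.\<close>
  have transfer: "(\<integral>s. u (\<xi> k s) \<partial>S) = (\<integral>x. u x \<partial>\<rho>)" "integrable S (\<lambda>s. u (\<xi> k s)) = integrable \<rho> u"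
    if [measurable]: "u \<in> borel_measurable \<rho>" for u :: "_ \<Rightarrow> real" and k
    using integral_distr[OF \<xi> that, of k] integrable_distr_eq[OF \<xi> that, of k]
    by (simp_all add: distr)
  have g0: "(\<integral>x. g x \<partial>\<rho>) = 0"
    unfolding g_def using h_int by (simp add: \<rho>.prob_space \<mu>_def)
  have g_int: "integrable \<rho> g"
    unfolding g_def using h_int by simp
  define Z where "Z k s = g (\<xi> k s)" for k s
  have Z_iv: "S.indep_vars (\<lambda>_. borel) Z UNIV"
    unfolding Z_def by (rule S.indep_vars_compose2[OF iv]) measurable
  have Z_int: "integrable S (Z k)" for k
    unfolding Z_def by (simp add: transfer g_int)
  have "AE s in S. (\<lambda>m. (\<Sum>k<m. Z k s) / m) \<longlonglongrightarrow> 0"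
  proof (rule AE_orthogonal_averages_tendsto_0)
    have "Z k \<in> borel_measurable S" for k
      unfolding Z_def by measurable
    then show "Z k \<in> L2 S" for k
      using g transfer(2)[of "\<lambda>x. (g x)\<^sup>2" k] by (simp add: L2_def Z_def)
    show "l2_inner S (Z k) (Z k) \<le> l2_inner \<rho> g g" for k
      using transfer(1)[of "\<lambda>x. g x * g x" k] by (simp add: l2_inner_def Z_def)
    fix j k :: nat assume "j \<noteq> k"
    \<comment> \<open>Independence factorises the integral over the two-element index set, and each
      factor is the mean of \<open>g\<close>, which is 0.\<close>
    moreover have "(\<integral>s. (\<Prod>i\<in>{j, k}. Z i s) \<partial>S) = (\<Prod>i\<in>{j, k}. \<integral>s. Z i s \<partial>S)"
      using Z_int by (intro S.indep_vars_lebesgue_integral S.indep_vars_subset[OF Z_iv]) auto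
    ultimately show "l2_inner S (Z j) (Z k) = 0"
      by (simp add: l2_inner_def Z_def transfer g0)
  qed
  then show ?thesis
  proof eventually_elim
    case (elim s)
    then have "(\<lambda>m. (\<Sum>k<m. Z k s) / m + \<mu>) \<longlonglongrightarrow> 0 + \<mu>"
      by (intro tendsto_intros)
    \<comment> \<open>The index \<open>m = 0\<close> is excluded: there the quotients are 0 and the
      left side is \<mu>.\<close>
    moreover have "\<forall>\<^sub>F m in sequentially. (\<Sum>k<m. Z k s) / real m + \<mu> = (\<Sum>k<m. h (\<xi> k s)) / m"
      using eventually_gt_at_top[of 0]
      by eventually_elim (simp add: Z_def g_def sum_subtractf field_simps)
    ultimately have "(\<lambda>m. (\<Sum>k<m. h (\<xi> k s)) / m) \<longlonglongrightarrow> 0 + \<mu>"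
      by (rule Lim_transform_eventually)
    then show ?case by (simp add: \<mu>_def)
  qed
qed

section \<open>Inverse matrices and the pseudoinverse\<close>

text \<open>The adjugate formula gives explicit entries, from which continuity of inversion can be
  read off. For a singular argument the convention \<open>1 / 0 = 0\<close> yields the zero
  matrix.\<close>

definition inv_mat :: "real mat \<Rightarrow> real mat" where
  "inv_mat A = (1 / Determinant.det A) \<cdot>\<^sub>m adj_mat A"

lemma inv_mat_carrier [simp]: "A \<in> carrier_mat n n \<Longrightarrow> inv_mat A \<in> carrier_mat n n"
  by (simp add: inv_mat_def adj_mat(1))

lemma inv_mat_left:
  assumes A: "A \<in> carrier_mat n n" and det: "Determinant.det A \<noteq> 0"
  shows "inv_mat A * A = 1\<^sub>m n"
proof -
  have "inv_mat A * A = (1 / Determinant.det A) \<cdot>\<^sub>m (Determinant.det A \<cdot>\<^sub>m 1\<^sub>m n)"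
    unfolding inv_mat_def using adj_mat[OF A] A by (simp add: mult_smult_assoc_mat)
  then show ?thesis using det by (auto intro!: eq_matI)
qed

lemma inv_mat_right:
  assumes A: "A \<in> carrier_mat n n" and det: "Determinant.det A \<noteq> 0"
  shows "A * inv_mat A = 1\<^sub>m n"
  using mat_mult_left_right_inverse[OF inv_mat_carrier[OF A] A inv_mat_left[OF A det]] .

text \<open>Transposing \<open>A * inv_mat A = 1\<close> shows that the transposed inverse is a left
  inverse of \<open>A\<close>, and multiplying by the right inverse identifies the two.\<close>

lemma inv_mat_symmetric:
  assumes A: "A \<in> carrier_mat n n" and det: "Determinant.det A \<noteq> 0"
    and sym: "transpose_mat A = A"
  shows "transpose_mat (inv_mat A) = inv_mat A"
proof -
  let ?B = "inv_mat A"
  have B: "?B \<in> carrier_mat n n" "transpose_mat ?B \<in> carrier_mat n n"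
    using A by auto
  have "transpose_mat ?B * A = transpose_mat (A * ?B)"
    using A B by (simp add: transpose_mult[of A n n ?B n] sym)
  also have "\<dots> = 1\<^sub>m n"
    by (simp add: inv_mat_right[OF A det])
  finally have "(transpose_mat ?B * A) * ?B = ?B"
    using B by simp
  then show ?thesis
    using A B by (simp add: assoc_mult_mat[of _ n n] inv_mat_right[OF A det])
qed

text \<open>The full column rank case: a left inverse \<open>B\<close> with \<open>A * B\<close>
  symmetric satisfies all four Penrose equations. Any competitor \<open>C\<close> also has
  \<open>C * A = 1\<close> and \<open>A * C = A * B\<close>, so
  \<open>C = C * A * C = C * A * B = B\<close>.\<close>

lemma pinv_eq:
  assumes A: "A \<in> carrier_mat m n" and B: "B \<in> carrier_mat n m"
    and left: "B * A = 1\<^sub>m n" and sym: "transpose_mat (A * B) = A * B"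
  shows "pinv A = B"
  unfolding pinv_def
proof (rule the_equality)
  have "A * B * A = A" "B * A * B = B"
    using A B by (simp_all add: left assoc_mult_mat[of A m n B m A n])
  then show "B \<in> carrier_mat (dim_col A) (dim_row A) \<and>
     A * B * A = A \<and> B * A * B = B \<and>
     transpose_mat (A * B) = A * B \<and> transpose_mat (B * A) = B * A"
    using A B left sym by auto
next
  fix C assume C': "C \<in> carrier_mat (dim_col A) (dim_row A) \<and>
     A * C * A = A \<and> C * A * C = C \<and>
     transpose_mat (A * C) = A * C \<and> transpose_mat (C * A) = C * A"
  then have C: "C \<in> carrier_mat n m" and AC: "transpose_mat (A * C) = A * C"
    and pen: "A * C * A = A" "C * A * C = C"
    using A by auto
  have "C * A = (B * A) * (C * A)"
    using A C by (simp add: left)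
  also have "\<dots> = B * (A * C * A)"
    using A B C
    by (simp add: assoc_mult_mat[of B n m A n "C * A" n] assoc_mult_mat[of A m n C m A n])
  finally have CA: "C * A = 1\<^sub>m n" by (simp add: pen left)
  \<comment> \<open>Both \<open>A * B\<close> and \<open>A * C\<close> are symmetric and fix
    \<open>A\<close> from the left. Transposing the product swaps its factors, after which it
    collapses to \<open>A * B\<close>.\<close>
  have "A * C = (A * B) * (A * C)"
    using A B C by (simp add: assoc_mult_mat[of A m n B m "A * C" m] left
        flip: assoc_mult_mat[of B n m A n C m])
  also have "\<dots> = transpose_mat (A * B) * transpose_mat (A * C)"
    by (simp add: sym AC)
  also have "\<dots> = transpose_mat ((A * C) * (A * B))"
    using A B C by (simp add: transpose_mult[of "A * C" m m "A * B" m])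
  also have "(A * C) * (A * B) = A * B"
    using A B C by (simp add: assoc_mult_mat[of A m n C m "A * B" m] CA
        flip: assoc_mult_mat[of C n m A n B m])
  finally have AC_AB: "A * C = A * B" by (simp add: sym)
  have "C = C * (A * C)" using pen A C by (simp add: assoc_mult_mat[of C n m A n C m])
  also have "\<dots> = (C * A) * B"
    using A B C by (simp add: AC_AB assoc_mult_mat[of C n m A n B m])
  finally show "C = B" using B by (simp add: CA)
qed

text \<open>By the Leibniz formula the determinant is a polynomial in the entries.\<close>

lemma tendsto_det:
  assumes A: "\<And>x. A x \<in> carrier_mat n n" and L: "L \<in> carrier_mat n n"
    and lim: "\<And>i j. i < n \<Longrightarrow> j < n \<Longrightarrow> ((\<lambda>x. A x $$ (i, j)) \<longlongrightarrow> L $$ (i, j)) F"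
  shows "((\<lambda>x. Determinant.det (A x)) \<longlongrightarrow> (Determinant.det L :: real)) F"
proof -
  have "i < n \<Longrightarrow> p permutes {0..<n} \<Longrightarrow> p i < n" for p i
    using permutes_in_image[of p "{0..<n}" i] by auto
  then show ?thesis
    unfolding det_def'[OF A] det_def'[OF L]
    by (intro tendsto_sum tendsto_mult tendsto_const tendsto_prod lim) auto
qed

text \<open>Every entry of the inverse is a signed minor divided by the determinant. Minors are
  determinants of size \<open>n - 1\<close>, so both parts converge, and the limiting denominator is
  nonzero.\<close>

lemma tendsto_inv_mat:
  assumes A: "\<And>x. A x \<in> carrier_mat n n" and L: "L \<in> carrier_mat n n"
    and det: "Determinant.det L \<noteq> 0"
    and lim: "\<And>i j. i < n \<Longrightarrow> j < n \<Longrightarrow> ((\<lambda>x. A x $$ (i, j)) \<longlongrightarrow> L $$ (i, j)) F"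
    and ij: "i < n" "j < n"
  shows "((\<lambda>x. inv_mat (A x) $$ (i, j)) \<longlongrightarrow> inv_mat L $$ (i, j)) F"
proof -
  have del: "((\<lambda>x. Determinant.det (mat_delete (A x) j i)) \<longlongrightarrow> Determinant.det (mat_delete L j i)) F"
  proof (rule tendsto_det)
    show "mat_delete (A x) j i \<in> carrier_mat (n - 1) (n - 1)" for x
      by (rule mat_delete_carrier[OF A])
    show "mat_delete L j i \<in> carrier_mat (n - 1) (n - 1)"
      by (rule mat_delete_carrier[OF L])
    show "((\<lambda>x. mat_delete (A x) j i $$ (k, l)) \<longlongrightarrow> mat_delete L j i $$ (k, l)) F"
      if "k < n - 1" "l < n - 1" for k l
      using that A[THEN carrier_matD(1)] A[THEN carrier_matD(2)] L
      unfolding mat_delete_def by (auto intro!: lim)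
  qed
  \<comment> \<open>The adjugate is the transposed cofactor matrix, so entry \<open>(i, j)\<close>
    deletes row \<open>j\<close> and column \<open>i\<close>.\<close>
  have entry: "inv_mat B $$ (i, j)
      = 1 / Determinant.det B * ((- 1) ^ (j + i) * Determinant.det (mat_delete B j i))"
    if "B \<in> carrier_mat n n" for B
    using that ij by (simp add: inv_mat_def adj_mat_def cofactor_def)
  show ?thesis
    unfolding entry[OF A] entry[OF L]
    by (intro tendsto_intros del tendsto_det[OF A L] lim det)
qed

lemma mult_mat_entry:
  "A \<in> carrier_mat m n \<Longrightarrow> B \<in> carrier_mat n p \<Longrightarrow> i < m \<Longrightarrow> j < p \<Longrightarrow>
    (A * B) $$ (i, j) = (\<Sum>k<n. A $$ (i, k) * B $$ (k, j))"
  by (auto simp: scalar_prod_def atLeast0LessThan intro!: sum.cong)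

lemma mult_mat_vec_entry:
  "A \<in> carrier_mat m n \<Longrightarrow> v \<in> carrier_vec n \<Longrightarrow> i < m \<Longrightarrow>
    vec_index (A *\<^sub>v v) i = (\<Sum>k<n. A $$ (i, k) * vec_index v k)"
  by (auto simp: scalar_prod_def atLeast0LessThan intro!: sum.cong)

lemma tendsto_mult_mat:
  fixes A B :: "'x \<Rightarrow> real mat"
  assumes A: "\<And>x. A x \<in> carrier_mat m n" and B: "\<And>x. B x \<in> carrier_mat n p"
    and L: "L \<in> carrier_mat m n" and K: "K \<in> carrier_mat n p"
    and limA: "\<And>i j. i < m \<Longrightarrow> j < n \<Longrightarrow> ((\<lambda>x. A x $$ (i, j)) \<longlongrightarrow> L $$ (i, j)) F"
    and limB: "\<And>i j. i < n \<Longrightarrow> j < p \<Longrightarrow> ((\<lambda>x. B x $$ (i, j)) \<longlongrightarrow> K $$ (i, j)) F"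
    and ij: "i < m" "j < p"
  shows "((\<lambda>x. (A x * B x) $$ (i, j)) \<longlongrightarrow> (L * K) $$ (i, j)) F"
  unfolding mult_mat_entry[OF A B ij] mult_mat_entry[OF L K ij]
  using ij by (intro tendsto_sum tendsto_mult limA limB) auto

section \<open>Empirical Gram matrices and the EDMD matrix\<close>

lemma data_matrix_carrier [simp]: "data_matrix m N \<phi> x \<in> carrier_mat m N"
  by (simp add: data_matrix_def)

definition empirical_gram ::
  "nat \<Rightarrow> nat \<Rightarrow> (nat \<Rightarrow> 'a \<Rightarrow> real) \<Rightarrow> (nat \<Rightarrow> 'a \<Rightarrow> real) \<Rightarrow> (nat \<Rightarrow> 'a) \<Rightarrow> real mat" where
  "empirical_gram m N \<psi> \<phi> x =
     Matrix.mat N N (\<lambda>(i, j). (\<Sum>k<m. \<psi> i (x k) * \<phi> j (x k)) / m)"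

lemma empirical_gram_carrier [simp]: "empirical_gram m N \<psi> \<phi> x \<in> carrier_mat N N"
  by (simp add: empirical_gram_def)

lemma transpose_data_matrix_mult:
  assumes "m > 0"
  shows "(1 / real m) \<cdot>\<^sub>m (transpose_mat (data_matrix m N \<psi> x) * data_matrix m N \<phi> x)
    = empirical_gram m N \<psi> \<phi> x"
  using assms
  by (auto intro!: eq_matI simp: empirical_gram_def data_matrix_def scalar_prod_def atLeast0LessThan)

text \<open>The normal equations: with invertible Gram matrix the pseudoinverse of \<open>A\<close>
  is the inverse of \<open>A^T A\<close> times \<open>A^T\<close>. The factors \<open>1 / m\<close>
  cancel, and they turn the entries into sample averages.\<close>

lemma pinv_data_matrix_mult:
  assumes m: "m > 0" and det: "Determinant.det (empirical_gram m N \<psi> \<psi> x) \<noteq> 0"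
  shows "pinv (data_matrix m N \<psi> x) * data_matrix m N \<phi> x
    = inv_mat (empirical_gram m N \<psi> \<psi> x) * empirical_gram m N \<psi> \<phi> x"
proof -
  define G where "G = empirical_gram m N \<psi> \<psi> x"
  define A where "A = data_matrix m N \<psi> x"
  define B where "B = inv_mat G * ((1 / real m) \<cdot>\<^sub>m transpose_mat A)"
  have G: "G \<in> carrier_mat N N" and A: "A \<in> carrier_mat m N"
    by (simp_all add: G_def A_def)
  have Gi: "inv_mat G \<in> carrier_mat N N" using G by simp
  have At: "(1 / real m) \<cdot>\<^sub>m transpose_mat A \<in> carrier_mat N m" using A by simp
  have B: "B \<in> carrier_mat N m" unfolding B_def using Gi At by simp
  \<comment> \<open>Stated for any family because it is used twice: with \<psi> it shows that
    \<open>B\<close> is a left inverse of \<open>A\<close>, with \<phi> it gives the claim.\<close>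
  have B_mult: "B * data_matrix m N \<phi>' x = inv_mat G * empirical_gram m N \<psi> \<phi>' x" for \<phi>'
  proof -
    have "B * data_matrix m N \<phi>' x
        = inv_mat G * (((1 / real m) \<cdot>\<^sub>m transpose_mat A) * data_matrix m N \<phi>' x)"
      unfolding B_def by (rule assoc_mult_mat[OF Gi At data_matrix_carrier])
    also have "((1 / real m) \<cdot>\<^sub>m transpose_mat A) * data_matrix m N \<phi>' x
        = (1 / real m) \<cdot>\<^sub>m (transpose_mat A * data_matrix m N \<phi>' x)"
      using A by (intro mult_smult_assoc_mat[of _ N m _ N]) auto
    finally show ?thesis
      unfolding A_def transpose_data_matrix_mult[OF m] .
  qed
  have detG: "Determinant.det G \<noteq> 0" using det by (simp add: G_def)
  have "transpose_mat G = G"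
    by (auto intro!: eq_matI simp: G_def empirical_gram_def mult.commute)
  then have Git: "transpose_mat (inv_mat G) = inv_mat G"
    by (rule inv_mat_symmetric[OF G detG])
  have AB: "A * B = (1 / real m) \<cdot>\<^sub>m (A * inv_mat G * transpose_mat A)"
    unfolding B_def using A Gi
    by (simp add: mult_smult_distrib[of _ N N _ m] mult_smult_distrib[of _ m N _ m]
        assoc_mult_mat[of A m N "inv_mat G" N "transpose_mat A" m])
  have "transpose_mat (A * inv_mat G * transpose_mat A) = A * inv_mat G * transpose_mat A"
    using A Gi
    by (simp add: transpose_mult[of A m N "inv_mat G * transpose_mat A" m]
        transpose_mult[of "inv_mat G" N N "transpose_mat A" m] Git)
  then have sym: "transpose_mat (A * B) = A * B"
    unfolding AB
    by (metis smult_mat_def map_mat_transpose)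
  have "B * A = 1\<^sub>m N"
    unfolding A_def B_mult using inv_mat_left[OF G detG] by (simp add: G_def)
  then have "pinv A = B"
    using pinv_eq[OF A B] sym by simp
  then show ?thesis
    using B_mult by (simp add: A_def G_def)
qed

text \<open>The remainder is exactly the Taylor error at the samples, so the three summands
  telescope and \<phi> drops out.\<close>

lemma edmd_matrix_eq:
  "edmd_matrix T m N \<psi> \<phi> \<Delta>t x
    = pinv (data_matrix m N \<psi> x) * data_matrix m N (\<lambda>j. T \<Delta>t (\<psi> j)) x"
proof -
  have "data_matrix m N \<psi> x + \<Delta>t \<cdot>\<^sub>m data_matrix m N \<phi> x + remainder_matrix T m N \<psi> \<phi> \<Delta>t x
      = data_matrix m N (\<lambda>j. T \<Delta>t (\<psi> j)) x"
    by (rule eq_matI) (auto simp: data_matrix_def remainder_matrix_def)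
  then show ?thesis by (simp add: edmd_matrix_def)
qed

section \<open>The Gram matrix and the dictionary space\<close>

locale L2_dictionary =
  fixes \<rho> :: "'a measure" and N :: nat and \<psi> :: "nat \<Rightarrow> 'a \<Rightarrow> real"
  assumes psi_L2: "\<And>i. i < N \<Longrightarrow> \<psi> i \<in> L2 \<rho>"
    and indep: "dict_independent \<rho> N \<psi>"
begin

text \<open>The right-hand family is left free: \<psi> gives the Gram matrix, the images under the
  generator give \<open>H\<close>, and the images under \<open>T t\<close> give the matrix of the
  Koopman operator at time \<open>t\<close>.\<close>

definition inner_mat :: "(nat \<Rightarrow> 'a \<Rightarrow> real) \<Rightarrow> real mat" where
  "inner_mat \<phi> = Matrix.mat N N (\<lambda>(i, j). l2_inner \<rho> (\<psi> i) (\<phi> j))"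

abbreviation "gram \<equiv> inner_mat \<psi>"
abbreviation "gram_inv \<equiv> inv_mat (inner_mat \<psi>)"

lemma inner_mat_carrier [simp]: "inner_mat \<phi> \<in> carrier_mat N N"
  by (simp add: inner_mat_def)

lemma inner_mat_entry [simp]: "i < N \<Longrightarrow> j < N \<Longrightarrow> inner_mat \<phi> $$ (i, j) = l2_inner \<rho> (\<psi> i) (\<phi> j)"
  by (simp add: inner_mat_def)

lemma comb_L2: "(\<And>i. i < N \<Longrightarrow> \<phi> i \<in> L2 \<rho>) \<Longrightarrow> dict_comb N \<phi> a \<in> L2 \<rho>"
  unfolding dict_comb_def by (intro L2_sum) auto

lemma dict_comb_L2 [simp]: "dict_comb N \<psi> a \<in> L2 \<rho>"
  by (rule comb_L2) (rule psi_L2)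

lemma dict_comb_diff:
  assumes "u \<in> carrier_vec N" "v \<in> carrier_vec N"
  shows "dict_comb N \<phi> (u - v) = (\<lambda>x. dict_comb N \<phi> u x - dict_comb N \<phi> v x)"
  using assms by (auto simp: dict_comb_def right_diff_distrib sum_subtractf)

lemma l2_inner_comb_right:
  assumes \<phi>: "\<And>i. i < N \<Longrightarrow> \<phi> i \<in> L2 \<rho>" and a: "a \<in> carrier_vec N" and i: "i < N"
  shows "l2_inner \<rho> (\<psi> i) (dict_comb N \<phi> a) = vec_index (inner_mat \<phi> *\<^sub>v a) i"
proof -
  have "l2_inner \<rho> (\<psi> i) (dict_comb N \<phi> a) = (\<Sum>k<N. l2_inner \<rho> (\<psi> i) (\<phi> k) * vec_index a k)"
    unfolding dict_comb_def using psi_L2[OF i] \<phi> by (intro l2_inner_sum_right) auto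
  then show ?thesis
    using i mult_mat_vec_entry[OF inner_mat_carrier a i, of \<phi>] by simp
qed

section \<open>Uniqueness of coefficients, invertibility of the Gram matrix, and the
  projection\<close>

lemma dict_comb_eq_AE_imp_eq:
  assumes "a \<in> carrier_vec N" "b \<in> carrier_vec N"
    and "AE x in \<rho>. dict_comb N \<psi> a x = dict_comb N \<psi> b x"
  shows "a = b"
proof -
  have "a - b = 0\<^sub>v N"
    using indep assms by (auto simp: dict_independent_def dict_comb_diff)
  moreover have "a = (a - b) + b" using assms by (intro eq_vecI) auto
  ultimately show ?thesis using assms by simp
qed

lemma dict_coeffs_comb: "a \<in> carrier_vec N \<Longrightarrow> dict_coeffs N \<psi> (dict_comb N \<psi> a) = a"
  unfolding dict_coeffs_def by (rule the_equality) (auto intro: dict_comb_eq_AE_imp_eq)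

text \<open>A kernel vector \<open>a\<close> of the Gram matrix gives a combination of squared norm
  \<open>a^T G a = 0\<close>, hence one vanishing almost everywhere, against independence.\<close>

lemma det_gram: "Determinant.det gram \<noteq> 0"
proof
  assume "Determinant.det gram = 0"
  then obtain a where a: "a \<in> carrier_vec N" "a \<noteq> 0\<^sub>v N" "gram *\<^sub>v a = 0\<^sub>v N"
    using det_0_iff_vec_prod_zero_field[OF inner_mat_carrier] by blast
  let ?f = "dict_comb N \<psi> a"
  have "l2_inner \<rho> ?f ?f = (\<Sum>i<N. l2_inner \<rho> ?f (\<psi> i) * vec_index a i)"
    unfolding dict_comb_def[of N \<psi> a, THEN arg_cong, of "l2_inner \<rho> ?f"]
    by (rule l2_inner_sum_right) (auto simp: psi_L2)
  also have "\<dots> = 0"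
    using a by (intro sum.neutral) (auto simp: l2_inner_commute[of _ ?f] l2_inner_comb_right psi_L2)
  finally have "AE x in \<rho>. ?f x = 0"
    by (simp add: l2_inner_self_eq_0)
  then show False
    using indep a by (auto simp: dict_independent_def)
qed

lemma gram_inv_carrier [simp]: "gram_inv \<in> carrier_mat N N"
  by simp

lemma gram_inv_mult_carrier [simp]: "A \<in> carrier_mat N N \<Longrightarrow> gram_inv * A \<in> carrier_mat N N"
  by (rule mult_carrier_mat[OF gram_inv_carrier])

text \<open>Testing against the dictionary suffices by linearity. For uniqueness, the difference
  \<open>d\<close> of two candidates lies in the span and is orthogonal to itself; independence then
  upgrades almost everywhere equality to equality of functions, as the definite description
  demands.\<close>

lemma dict_proj_eqI:
  assumes f: "f \<in> L2 \<rho>" and a: "a \<in> carrier_vec N"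
    and orth: "\<And>i. i < N \<Longrightarrow> l2_inner \<rho> (\<psi> i) f = l2_inner \<rho> (\<psi> i) (dict_comb N \<psi> a)"
  shows "dict_proj \<rho> N \<psi> f = dict_comb N \<psi> a"
  unfolding dict_proj_def
proof (rule the_equality)
  show "dict_comb N \<psi> a \<in> dict_span N \<psi> \<and>
    (\<forall>h\<in>dict_span N \<psi>. l2_inner \<rho> (\<lambda>x. f x - dict_comb N \<psi> a x) h = 0)"
  proof (intro conjI ballI)
    fix h assume "h \<in> dict_span N \<psi>"
    then obtain b where h: "h = dict_comb N \<psi> b" by (auto simp: dict_span_def)
    have "l2_inner \<rho> (\<lambda>x. f x - dict_comb N \<psi> a x) h
        = (\<Sum>i<N. l2_inner \<rho> (\<lambda>x. f x - dict_comb N \<psi> a x) (\<psi> i) * vec_index b i)"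
      unfolding h dict_comb_def[of N \<psi> b]
      by (rule l2_inner_sum_right) (auto intro: L2_diff f psi_L2)
    also have "\<dots> = 0"
      by (intro sum.neutral)
        (auto simp: l2_inner_commute[of _ _ "\<psi> _"] l2_inner_diff_right psi_L2 f orth)
    finally show "l2_inner \<rho> (\<lambda>x. f x - dict_comb N \<psi> a x) h = 0" .
  qed (use a in \<open>auto simp: dict_span_def\<close>)
next
  fix g assume g: "g \<in> dict_span N \<psi> \<and>
    (\<forall>h\<in>dict_span N \<psi>. l2_inner \<rho> (\<lambda>x. f x - g x) h = 0)"
  then obtain b where b: "b \<in> carrier_vec N" "g = dict_comb N \<psi> b"
    by (auto simp: dict_span_def)
  define d where "d = dict_comb N \<psi> (a - b)"
  have d_eq: "d = (\<lambda>x. dict_comb N \<psi> a x - g x)"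
    using a b by (simp add: d_def dict_comb_diff)
  have d_span: "d \<in> dict_span N \<psi>" using a b by (auto simp: d_def dict_span_def)
  have L2: "d \<in> L2 \<rho>" "g \<in> L2 \<rho>" by (simp_all add: d_def b)
  have "l2_inner \<rho> d f = l2_inner \<rho> d g"
    using g d_span l2_inner_diff_right[OF L2(1) f L2(2)] by (simp add: l2_inner_commute[of _ d])
  moreover have "l2_inner \<rho> d f = l2_inner \<rho> d (dict_comb N \<psi> a)"
  proof -
    have "l2_inner \<rho> h d = (\<Sum>i<N. l2_inner \<rho> h (\<psi> i) * vec_index (a - b) i)" if "h \<in> L2 \<rho>" for h
      unfolding d_def dict_comb_def using that by (intro l2_inner_sum_right) (auto simp: psi_L2)
    then show ?thesis
      using f orth by (simp add: l2_inner_commute[of _ d] l2_inner_commute[of _ _ "\<psi> _"])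
  qed
  ultimately have "l2_inner \<rho> d d = 0"
    using l2_inner_diff_right[OF L2(1) dict_comb_L2 L2(2), of a]
      arg_cong[OF d_eq, of "l2_inner \<rho> d"] by simp
  then have "AE x in \<rho>. dict_comb N \<psi> a x = dict_comb N \<psi> b x"
    using L2 by (simp add: l2_inner_self_eq_0 d_eq b)
  then show "g = dict_comb N \<psi> a"
    using dict_comb_eq_AE_imp_eq[OF a b(1)] b by simp
qed

text \<open>The coefficients solve the normal equations. \<open>g\<close> is only required to agree
  almost everywhere with a combination because the generator returns an arbitrary
  representative.\<close>

lemma dict_proj_comb:
  assumes \<phi>: "\<And>i. i < N \<Longrightarrow> \<phi> i \<in> L2 \<rho>" and a: "a \<in> carrier_vec N"
    and g: "g \<in> L2 \<rho>" "AE x in \<rho>. g x = dict_comb N \<phi> a x"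
  shows "dict_proj \<rho> N \<psi> g = dict_comb N \<psi> ((gram_inv * inner_mat \<phi>) *\<^sub>v a)"
proof (rule dict_proj_eqI[OF g(1)])
  let ?v = "(gram_inv * inner_mat \<phi>) *\<^sub>v a"
  show v: "?v \<in> carrier_vec N"
    using a by (rule mult_mat_vec_carrier[OF gram_inv_mult_carrier[OF inner_mat_carrier]])
  have "gram *\<^sub>v ?v = (gram * (gram_inv * inner_mat \<phi>)) *\<^sub>v a"
    using a by (intro assoc_mult_mat_vec[symmetric, of _ N N _ N]) auto
  also have "gram * (gram_inv * inner_mat \<phi>) = (gram * gram_inv) * inner_mat \<phi>"
    by (intro assoc_mult_mat[symmetric, of _ N N _ N _ N]) auto
  also have "\<dots> = inner_mat \<phi>"
    using inv_mat_right[OF inner_mat_carrier det_gram]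
    by (simp only: left_mult_one_mat[OF inner_mat_carrier])
  finally have eq: "gram *\<^sub>v ?v = inner_mat \<phi> *\<^sub>v a" .
  fix i assume i: "i < N"
  have [measurable]: "g \<in> borel_measurable \<rho>" "\<psi> i \<in> borel_measurable \<rho>"
    "dict_comb N \<phi> a \<in> borel_measurable \<rho>"
    using g psi_L2[OF i] comb_L2[OF \<phi>] by (auto intro: L2_measurable)
  have "l2_inner \<rho> (\<psi> i) g = l2_inner \<rho> (\<psi> i) (dict_comb N \<phi> a)"
    unfolding l2_inner_def using g(2) by (intro integral_cong_AE) auto
  also have "\<dots> = l2_inner \<rho> (\<psi> i) (dict_comb N \<psi> ?v)"
    using l2_inner_comb_right[OF \<phi> a i] l2_inner_comb_right[OF psi_L2 v i] eq by simp
  finally show "l2_inner \<rho> (\<psi> i) g = l2_inner \<rho> (\<psi> i) (dict_comb N \<psi> ?v)" .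
qed

lemma dict_proj_id: "a \<in> carrier_vec N \<Longrightarrow> dict_proj \<rho> N \<psi> (dict_comb N \<psi> a) = dict_comb N \<psi> a"
  by (rule dict_proj_eqI) auto

section \<open>Coefficient bounds and the operator norm on the span\<close>

definition coeff_const :: "nat \<Rightarrow> real" where
  "coeff_const j = (\<Sum>l<N. \<bar>gram_inv $$ (j, l)\<bar> * l2_norm \<rho> (\<psi> l))"

lemma coeff_const_nonneg: "0 \<le> coeff_const j"
  unfolding coeff_const_def by (intro sum_nonneg mult_nonneg_nonneg) (auto simp: l2_norm_nonneg)

text \<open>The entries of \<open>gram *\<^sub>v a\<close> are the inner products of the combination
  with the dictionary. Applying \<open>gram_inv\<close> recovers \<open>a\<close>, and
  Cauchy-Schwarz bounds each term.\<close>

lemma abs_coeff_le: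
  assumes a: "a \<in> carrier_vec N" and j: "j < N"
  shows "\<bar>vec_index a j\<bar> \<le> coeff_const j * l2_norm \<rho> (dict_comb N \<psi> a)"
proof -
  let ?f = "dict_comb N \<psi> a"
  have "a = (gram_inv * gram) *\<^sub>v a"
    using a by (simp add: inv_mat_left[OF inner_mat_carrier det_gram])
  also have "\<dots> = gram_inv *\<^sub>v (gram *\<^sub>v a)"
    using a by (intro assoc_mult_mat_vec[of _ N N _ N]) auto
  finally have "vec_index a j = (\<Sum>l<N. gram_inv $$ (j, l) * vec_index (gram *\<^sub>v a) l)"
    using mult_mat_vec_entry[OF gram_inv_carrier _ j, of "gram *\<^sub>v a"] a
    by (metis inner_mat_carrier mult_mat_vec_carrier)
  then have "vec_index a j = (\<Sum>l<N. gram_inv $$ (j, l) * l2_inner \<rho> (\<psi> l) ?f)"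
    using a psi_L2 by (simp add: l2_inner_comb_right)
  then have "\<bar>vec_index a j\<bar> \<le> (\<Sum>l<N. \<bar>gram_inv $$ (j, l) * l2_inner \<rho> (\<psi> l) ?f\<bar>)"
    by simp
  also have "\<dots> \<le> (\<Sum>l<N. \<bar>gram_inv $$ (j, l)\<bar> * (l2_norm \<rho> (\<psi> l) * l2_norm \<rho> ?f))"
    unfolding abs_mult
    by (intro sum_mono mult_left_mono l2_Cauchy_Schwarz) (auto simp: psi_L2)
  finally show ?thesis
    by (simp add: coeff_const_def sum_distrib_right mult.assoc)
qed

text \<open>On the unit ball the coefficients are bounded by \<open>coeff_const\<close>, so the
  triangle inequality bounds the image by a weighted sum of the entries of \<open>E\<close>. The
  weights do not depend on \<open>E\<close>.\<close>

lemma dict_opnorm_mult_mat_bounds: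
  assumes E: "E \<in> carrier_mat N N"
    and T: "\<And>a. a \<in> carrier_vec N \<Longrightarrow> T (dict_comb N \<psi> a) = dict_comb N \<psi> (E *\<^sub>v a)"
  defines "K \<equiv> \<Sum>i<N. \<Sum>j<N. \<bar>E $$ (i, j)\<bar> * (coeff_const j * l2_norm \<rho> (\<psi> i))"
  shows "0 \<le> dict_opnorm \<rho> N \<psi> T" and "dict_opnorm \<rho> N \<psi> T \<le> K"
proof -
  let ?U = "{f \<in> dict_span N \<psi>. l2_norm \<rho> f \<le> 1}"
  have le: "l2_norm \<rho> (T f) \<le> K" if "f \<in> ?U" for f
  proof -
    obtain a where a: "a \<in> carrier_vec N" and f: "f = dict_comb N \<psi> a"
      using \<open>f \<in> ?U\<close> by (auto simp: dict_span_def)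
    have coeff: "\<bar>vec_index a j\<bar> \<le> coeff_const j" if "j < N" for j
    proof -
      have "\<bar>vec_index a j\<bar> \<le> coeff_const j * l2_norm \<rho> f"
        unfolding f by (rule abs_coeff_le[OF a that])
      also have "\<dots> \<le> coeff_const j * 1"
        using \<open>f \<in> ?U\<close> by (intro mult_left_mono) (auto simp: coeff_const_nonneg)
      finally show ?thesis by simp
    qed
    have "l2_norm \<rho> (T f) \<le> (\<Sum>i<N. l2_norm \<rho> (\<psi> i) * \<bar>vec_index (E *\<^sub>v a) i\<bar>)"
      unfolding f T[OF a] dict_comb_def[of N \<psi> "E *\<^sub>v a"] by (rule l2_norm_sum_le) (auto simp: psi_L2)
    also have "\<dots> \<le> (\<Sum>i<N. l2_norm \<rho> (\<psi> i) * (\<Sum>j<N. \<bar>E $$ (i, j)\<bar> * coeff_const j))"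
    proof (intro sum_mono mult_left_mono l2_norm_nonneg)
      fix i assume "i \<in> {..<N}"
      then have "\<bar>vec_index (E *\<^sub>v a) i\<bar> \<le> (\<Sum>j<N. \<bar>E $$ (i, j) * vec_index a j\<bar>)"
        using mult_mat_vec_entry[OF E a, of i] by simp
      also have "\<dots> \<le> (\<Sum>j<N. \<bar>E $$ (i, j)\<bar> * coeff_const j)"
        unfolding abs_mult by (intro sum_mono mult_left_mono coeff) auto
      finally show "\<bar>vec_index (E *\<^sub>v a) i\<bar> \<le> (\<Sum>j<N. \<bar>E $$ (i, j)\<bar> * coeff_const j)" .
    qed
    also have "\<dots> = K"
      by (simp add: K_def sum_distrib_left mult_ac)
    finally show ?thesis .
  qed
  have zero: "dict_comb N \<psi> (0\<^sub>v N) = (\<lambda>x. 0)"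
    by (auto simp: dict_comb_def)
  \<comment> \<open>The zero combination makes the index set of the supremum nonempty; together with
    the upper bound \<open>le\<close> this lets the supremum be compared with its values.\<close>
  have mem: "dict_comb N \<psi> (0\<^sub>v N) \<in> ?U"
    by (auto simp: dict_span_def) (simp add: zero l2_norm_def l2_inner_def)
  have "l2_norm \<rho> (T (dict_comb N \<psi> (0\<^sub>v N))) \<le> dict_opnorm \<rho> N \<psi> T"
    unfolding dict_opnorm_def using mem le by (intro cSUP_upper bdd_aboveI2)
  then show "0 \<le> dict_opnorm \<rho> N \<psi> T"
    using l2_norm_nonneg order_trans by blast
  show "dict_opnorm \<rho> N \<psi> T \<le> K"
    unfolding dict_opnorm_def using mem le by (intro cSUP_least) auto
qed

lemma dict_opnorm_tendsto_0:
  assumes E: "\<And>t. E t \<in> carrier_mat N N"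
    and T: "\<forall>\<^sub>F t in F. \<forall>a\<in>carrier_vec N. T t (dict_comb N \<psi> a) = dict_comb N \<psi> (E t *\<^sub>v a)"
    and lim: "\<And>i j. i < N \<Longrightarrow> j < N \<Longrightarrow> ((\<lambda>t. E t $$ (i, j)) \<longlongrightarrow> 0) F"
  shows "((\<lambda>t. dict_opnorm \<rho> N \<psi> (T t)) \<longlongrightarrow> 0) F"
proof (rule tendsto_sandwich)
  let ?K = "\<lambda>t. \<Sum>i<N. \<Sum>j<N. \<bar>E t $$ (i, j)\<bar> * (coeff_const j * l2_norm \<rho> (\<psi> i))"
  show "\<forall>\<^sub>F t in F. 0 \<le> dict_opnorm \<rho> N \<psi> (T t)"
    using T by eventually_elim (use dict_opnorm_mult_mat_bounds(1)[OF E] in auto)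
  show "\<forall>\<^sub>F t in F. dict_opnorm \<rho> N \<psi> (T t) \<le> ?K t"
    using T by eventually_elim (use dict_opnorm_mult_mat_bounds(2)[OF E] in auto)
  show "(?K \<longlongrightarrow> 0) F"
    by (intro tendsto_null_sum tendsto_mult_left_zero tendsto_rabs_zero lim) auto
qed simp

end

section \<open>The generator on the span\<close>

text \<open>Linearity holds only up to a null set for each pair of functions. The induction joins
  finitely many of these null sets.\<close>

lemma L2_bounded_linear_comb_AE:
  fixes n :: nat
  assumes T: "L2_bounded_linear \<rho> T" and f: "\<And>i. i < n \<Longrightarrow> f i \<in> L2 \<rho>"
  shows "AE x in \<rho>. T (\<lambda>y. \<Sum>i<n. f i y * c i) x = (\<Sum>i<n. T (f i) x * c i)"
  using f
proof (induction n)
  have lin: "AE x in \<rho>. T (\<lambda>y. \<alpha> * u y + \<beta> * v y) x = \<alpha> * T u x + \<beta> * T v x"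
    if "u \<in> L2 \<rho>" "v \<in> L2 \<rho>" for u v \<alpha> \<beta>
    using T that by (auto simp: L2_bounded_linear_def)
  {
    case 0
    \<comment> \<open>Zero scalars in the linearity clause give that \<open>T\<close> maps the zero
      function to 0 almost everywhere.\<close>
    show ?case using lin[OF L2_zero L2_zero, of 0 0] by simp
  next
    case (Suc n)
    have "(\<lambda>y. \<Sum>i<n. f i y * c i) \<in> L2 \<rho>"
      using Suc.prems by (intro L2_sum) auto
    from lin[OF this Suc.prems[of n], of 1 "c n"]
    have "AE x in \<rho>. T (\<lambda>y. (\<Sum>i<n. f i y * c i) + f n y * c n) x
        = T (\<lambda>y. \<Sum>i<n. f i y * c i) x + T (f n) x * c n"
      by (simp add: mult.commute[of "c n"])
    moreover have "AE x in \<rho>. T (\<lambda>y. \<Sum>i<n. f i y * c i) x = (\<Sum>i<n. T (f i) x * c i)"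
      using Suc by simp
    ultimately show ?case
      by eventually_elim simp
  }
qed

text \<open>Uniqueness of limits: the distance of \<open>g\<close> and \<open>h\<close> is at most
  the sum of their distances to the difference quotient. It controls the representative picked by
  the choice operator in \<open>generator\<close>.\<close>

lemma has_generator_unique_AE:
  assumes T: "\<And>t. t \<ge> 0 \<Longrightarrow> L2_bounded_linear \<rho> (T t)"
    and g: "has_generator \<rho> T f g" and h: "has_generator \<rho> T f h"
  shows "AE x in \<rho>. g x = h x"
proof -
  have L2: "f \<in> L2 \<rho>" "g \<in> L2 \<rho>" "h \<in> L2 \<rho>"
    using g h by (auto simp: has_generator_def)
  define q where "q t x = (T t f x - f x) / t" for t x
  have "((\<lambda>t. l2_norm \<rho> (\<lambda>x. q t x - g x) + l2_norm \<rho> (\<lambda>x. q t x - h x)) \<longlongrightarrow> 0 + 0) (at_right 0)"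
    using g h unfolding has_generator_def q_def by (intro tendsto_add) auto
  moreover have "\<forall>\<^sub>F t in at_right 0. l2_norm \<rho> (\<lambda>x. h x - g x)
      \<le> l2_norm \<rho> (\<lambda>x. q t x - g x) + l2_norm \<rho> (\<lambda>x. q t x - h x)"
    using eventually_at_right_less[of "0::real"]
  proof eventually_elim
    case (elim t)
    have q: "q t \<in> L2 \<rho>"
      using T[of t] elim L2 unfolding q_def
      by (intro L2_divide L2_diff) (auto simp: L2_bounded_linear_def)
    \<comment> \<open>The left side is \<open>h - g\<close>; the subtraction is written as
      multiplication by \<open>- 1\<close> to fit the triangle inequality.\<close>
    have "l2_norm \<rho> (\<lambda>x. (q t x - g x) + (q t x - h x) * (- 1))
        \<le> l2_norm \<rho> (\<lambda>x. q t x - g x) + l2_norm \<rho> (\<lambda>x. (q t x - h x) * (- 1))"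
      using q L2 by (intro l2_norm_triangle L2_mult_right L2_diff)
    then show ?case by (simp only: l2_norm_mult_right) (simp add: algebra_simps)
  qed
  ultimately have "l2_norm \<rho> (\<lambda>x. h x - g x) \<le> 0"
    using tendsto_lowerbound[OF _ _ trivial_limit_at_right_real] by fastforce
  then have "l2_norm \<rho> (\<lambda>x. h x - g x) = 0"
    using l2_norm_nonneg order_antisym by blast
  then have "l2_inner \<rho> (\<lambda>x. h x - g x) (\<lambda>x. h x - g x) = 0"
    by (simp flip: l2_norm_power2)
  then show ?thesis
    using L2_diff[OF L2(3,2)] by (auto simp: l2_inner_self_eq_0)
qed

text \<open>The domain is a linear subspace: almost everywhere, the error of the difference quotient
  of a combination is the same combination of the errors \<open>e t i\<close>, each of which tends
  to 0 in norm.\<close>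

lemma has_generator_comb:
  assumes T: "\<And>t. t \<ge> 0 \<Longrightarrow> L2_bounded_linear \<rho> (T t)"
    and gen: "\<And>i. i < N \<Longrightarrow> has_generator \<rho> T (\<psi> i) (\<phi> i)"
  shows "has_generator \<rho> T (dict_comb N \<psi> a) (dict_comb N \<phi> a)"
proof -
  have L2: "\<psi> i \<in> L2 \<rho>" "\<phi> i \<in> L2 \<rho>" if "i < N" for i
    using gen[OF that] by (auto simp: has_generator_def)
  have comb: "dict_comb N \<psi> a \<in> L2 \<rho>" "dict_comb N \<phi> a \<in> L2 \<rho>"
    unfolding dict_comb_def by (auto intro!: L2_sum L2)
  define e where "e t i x = (T t (\<psi> i) x - \<psi> i x) / t - \<phi> i x" for t i x
  have "((\<lambda>t. \<Sum>i<N. l2_norm \<rho> (e t i) * \<bar>vec_index a i\<bar>) \<longlongrightarrow> 0) (at_right 0)"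
    using gen unfolding has_generator_def e_def
    by (intro tendsto_null_sum tendsto_mult_left_zero) auto
  then have "((\<lambda>t. l2_norm \<rho> (\<lambda>x. (T t (dict_comb N \<psi> a) x - dict_comb N \<psi> a x) / t
      - dict_comb N \<phi> a x)) \<longlongrightarrow> 0) (at_right 0)"
  proof (rule Lim_null_comparison[rotated])
    show "\<forall>\<^sub>F t in at_right 0. norm (l2_norm \<rho> (\<lambda>x. (T t (dict_comb N \<psi> a) x - dict_comb N \<psi> a x) / t
      - dict_comb N \<phi> a x)) \<le> (\<Sum>i<N. l2_norm \<rho> (e t i) * \<bar>vec_index a i\<bar>)"
      using eventually_at_right_less[of "0::real"]
    proof eventually_elim
      case (elim t)
      have Tt: "L2_bounded_linear \<rho> (T t)" using T elim by simp
      then have T_L2: "f \<in> L2 \<rho> \<Longrightarrow> T t f \<in> L2 \<rho>" for f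
        by (simp add: L2_bounded_linear_def)
      have e: "e t i \<in> L2 \<rho>" if "i < N" for i
        unfolding e_def using L2[OF that] by (intro L2_diff L2_divide T_L2)
      have "AE x in \<rho>. T t (\<lambda>y. \<Sum>i<N. \<psi> i y * vec_index a i) x
          = (\<Sum>i<N. T t (\<psi> i) x * vec_index a i)"
        by (rule L2_bounded_linear_comb_AE[OF Tt]) (rule L2(1))
      then have "AE x in \<rho>. (T t (dict_comb N \<psi> a) x - dict_comb N \<psi> a x) / t - dict_comb N \<phi> a x
          = (\<Sum>i<N. e t i x * vec_index a i)"
      proof eventually_elim
        case (elim x)
        then show ?case
          unfolding dict_comb_def e_def
          by (simp add: sum_subtractf sum_divide_distrib left_diff_distrib diff_divide_distrib)
      qed
      moreover have "(\<lambda>x. (T t (dict_comb N \<psi> a) x - dict_comb N \<psi> a x) / t - dict_comb N \<phi> a x) \<in> L2 \<rho>"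
        by (intro L2_diff L2_divide T_L2 comb)
      moreover have "(\<lambda>x. \<Sum>i<N. e t i x * vec_index a i) \<in> L2 \<rho>"
        using e by (intro L2_sum) auto
      ultimately have "l2_norm \<rho> (\<lambda>x. (T t (dict_comb N \<psi> a) x - dict_comb N \<psi> a x) / t - dict_comb N \<phi> a x)
          = l2_norm \<rho> (\<lambda>x. \<Sum>i<N. e t i x * vec_index a i)"
        by (intro l2_norm_cong_AE L2_measurable)
      also have "\<dots> \<le> (\<Sum>i<N. l2_norm \<rho> (e t i) * \<bar>vec_index a i\<bar>)"
        by (rule l2_norm_sum_le) (use e in auto)
      finally show ?case by (simp add: l2_norm_nonneg)
    qed
  qed
  then show ?thesis
    using comb by (simp add: has_generator_def)
qed

text \<open>The inner projection fixes the span, the chosen image under the generator agrees almost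
  everywhere with the combination of the \<phi> i, and the outer projection does not see null
  sets.\<close>

lemma (in L2_dictionary) compressed_generator_comb:
  assumes T: "\<And>t. t \<ge> 0 \<Longrightarrow> L2_bounded_linear \<rho> (T t)"
    and gen: "\<And>i. i < N \<Longrightarrow> has_generator \<rho> T (\<psi> i) (\<phi> i)"
    and a: "a \<in> carrier_vec N"
  shows "compressed_generator \<rho> T N \<psi> (dict_comb N \<psi> a)
    = dict_comb N \<psi> ((gram_inv * inner_mat \<phi>) *\<^sub>v a)"
proof -
  let ?f = "dict_comb N \<psi> a"
  have comb: "has_generator \<rho> T ?f (dict_comb N \<phi> a)"
    by (rule has_generator_comb[OF T gen])
  then have "has_generator \<rho> T ?f (generator \<rho> T ?f)"
    unfolding generator_def by (rule someI[of "has_generator \<rho> T ?f"])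
  then have "generator \<rho> T ?f \<in> L2 \<rho>" "AE x in \<rho>. generator \<rho> T ?f x = dict_comb N \<phi> a x"
    using has_generator_unique_AE[OF T _ comb] by (auto simp: has_generator_def)
  then show ?thesis
    unfolding compressed_generator_def dict_proj_id[OF a]
    using gen a by (intro dict_proj_comb) (auto simp: has_generator_def)
qed

section \<open>The limit of infinitely many samples\<close>

text \<open>Holds by entrywise convergence of the empirical matrices together with continuity of
  inversion and multiplication. The definite description also requires that no other matrix is an
  almost sure limit.\<close>

lemma (in L2_dictionary) limit_matrix_eq:
  assumes samples: "iid_samples S \<rho> \<xi>"
    and T_L2: "\<And>j. j < N \<Longrightarrow> T \<Delta>t (\<psi> j) \<in> L2 \<rho>"
    and bound: "\<And>i. i < N \<Longrightarrow> AE x in \<rho>. \<bar>\<psi> i x\<bar> \<le> C"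
  shows "limit_matrix S \<xi> T N \<psi> \<phi> \<Delta>t = gram_inv * inner_mat (\<lambda>j. T \<Delta>t (\<psi> j))"
proof -
  interpret S: prob_space S using samples by (simp add: iid_samples_def)
  define \<eta> where "\<eta> = (\<lambda>j. T \<Delta>t (\<psi> j))"
  define K where "K = gram_inv * inner_mat \<eta>"
  have K: "K \<in> carrier_mat N N" by (simp add: K_def)
  have law: "AE s in S. (\<lambda>m. empirical_gram m N \<psi> \<theta> (\<lambda>k. \<xi> k s) $$ (i, j))
      \<longlonglongrightarrow> inner_mat \<theta> $$ (i, j)"
    if ij: "i < N" "j < N" and \<theta>: "\<And>j. j < N \<Longrightarrow> \<theta> j \<in> L2 \<rho>" for \<theta> i j
  proof -
    have [measurable]: "\<psi> i \<in> borel_measurable \<rho>" "\<theta> j \<in> borel_measurable \<rho>"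
      using psi_L2 \<theta> ij by (auto intro: L2_measurable)
    \<comment> \<open>The strong law above asks for square integrability. Boundedness of one factor
      reduces this to square integrability of the other.\<close>
    have "integrable \<rho> (\<lambda>x. (\<psi> i x * \<theta> j x)\<^sup>2)"
    proof (rule Bochner_Integration.integrable_bound)
      show "integrable \<rho> (\<lambda>x. C\<^sup>2 * (\<theta> j x)\<^sup>2)"
        using \<theta>[OF ij(2)] by (simp add: L2_def)
      show "AE x in \<rho>. norm ((\<psi> i x * \<theta> j x)\<^sup>2) \<le> norm (C\<^sup>2 * (\<theta> j x)\<^sup>2)"
        using bound[OF ij(1)]
      proof eventually_elim
        case (elim x)
        then have "(\<psi> i x)\<^sup>2 \<le> C\<^sup>2" by (intro sqrt_ge_absD abs_le_square_iff[THEN iffD1]) auto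
        then show ?case by (simp add: power_mult_distrib mult_right_mono)
      qed
    qed measurable
    then have "(\<lambda>x. \<psi> i x * \<theta> j x) \<in> L2 \<rho>" by (simp add: L2_def)
    from iid_samples_strong_law[OF samples this] show ?thesis
      using ij by (simp add: empirical_gram_def l2_inner_def)
  qed
  have "AE s in S. \<forall>i\<in>{..<N}. \<forall>j\<in>{..<N}.
      (\<lambda>m. empirical_gram m N \<psi> \<psi> (\<lambda>k. \<xi> k s) $$ (i, j)) \<longlonglongrightarrow> gram $$ (i, j)"
    by (intro AE_finite_allI law psi_L2) auto
  moreover have "AE s in S. \<forall>i\<in>{..<N}. \<forall>j\<in>{..<N}.
      (\<lambda>m. empirical_gram m N \<psi> \<eta> (\<lambda>k. \<xi> k s) $$ (i, j)) \<longlonglongrightarrow> inner_mat \<eta> $$ (i, j)"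
    by (intro AE_finite_allI law) (auto simp: \<eta>_def T_L2)
  ultimately have lim: "AE s in S. \<forall>i<N. \<forall>j<N.
      (\<lambda>m. edmd_matrix T m N \<psi> \<phi> \<Delta>t (\<lambda>k. \<xi> k s) $$ (i, j)) \<longlonglongrightarrow> K $$ (i, j)"
  proof eventually_elim
    case (elim s)
    let ?G = "\<lambda>m. empirical_gram m N \<psi> \<psi> (\<lambda>k. \<xi> k s)"
    let ?B = "\<lambda>m. empirical_gram m N \<psi> \<eta> (\<lambda>k. \<xi> k s)"
    have "(\<lambda>m. Determinant.det (?G m)) \<longlonglongrightarrow> Determinant.det gram"
      using elim(1) by (intro tendsto_det[where n = N]) auto
    \<comment> \<open>For few samples the empirical Gram matrix may be singular; eventually it
      inherits a nonzero determinant from its limit, and then the pseudoinverse formula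
      applies.\<close>
    then have "\<forall>\<^sub>F m in sequentially. Determinant.det (?G m) \<noteq> 0"
      by (rule tendsto_imp_eventually_ne) (rule det_gram)
    then have eq: "\<forall>\<^sub>F m in sequentially.
        inv_mat (?G m) * ?B m = edmd_matrix T m N \<psi> \<phi> \<Delta>t (\<lambda>k. \<xi> k s)"
      using eventually_gt_at_top[of 0]
      by eventually_elim (simp add: edmd_matrix_eq pinv_data_matrix_mult \<eta>_def)
    have Gi: "(\<lambda>m. inv_mat (?G m) $$ (i, j)) \<longlonglongrightarrow> gram_inv $$ (i, j)" if "i < N" "j < N" for i j
      using elim(1) that by (intro tendsto_inv_mat[where n = N] det_gram) auto
    have "(\<lambda>m. (inv_mat (?G m) * ?B m) $$ (i, j)) \<longlonglongrightarrow> K $$ (i, j)" if "i < N" "j < N" for i j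
      unfolding K_def using elim(2) that by (intro tendsto_mult_mat[where m = N and n = N and p = N] Gi) auto
    moreover have "\<forall>\<^sub>F m in sequentially. (inv_mat (?G m) * ?B m) $$ (i, j)
        = edmd_matrix T m N \<psi> \<phi> \<Delta>t (\<lambda>k. \<xi> k s) $$ (i, j)" for i j
      using eq by eventually_elim (rule arg_cong)
    ultimately show ?case
      by (intro allI impI) (rule Lim_transform_eventually)
  qed
  have "limit_matrix S \<xi> T N \<psi> \<phi> \<Delta>t = K"
    unfolding limit_matrix_def
  proof (rule the_equality)
    fix K' assume K': "K' \<in> carrier_mat N N \<and> (AE s in S. \<forall>i<N. \<forall>j<N.
        (\<lambda>m. edmd_matrix T m N \<psi> \<phi> \<Delta>t (\<lambda>k. \<xi> k s) $$ (i, j)) \<longlonglongrightarrow> K' $$ (i, j))"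
    \<comment> \<open>The equation does not mention \<open>s\<close>, so on a probability space
      holding almost surely means holding.\<close>
    have "AE s in S. K' = K"
      using lim conjunct2[OF K']
    proof eventually_elim
      case (elim s)
      then show ?case
        using K K' LIMSEQ_unique by (intro eq_matI) (blast, auto)
    qed
    then show "K' = K" by (simp add: S.AE_const)
  qed (use K lim in simp)
  then show ?thesis by (simp add: K_def \<eta>_def)
qed

text \<open>Norm convergence of the difference quotients implies weak convergence, by Cauchy-Schwarz
  against \<open>\<psi> i\<close>.\<close>

lemma (in L2_dictionary) tendsto_inner_mat_quotient:
  assumes T: "\<And>t. t \<ge> 0 \<Longrightarrow> L2_bounded_linear \<rho> (T t)"
    and gen: "has_generator \<rho> T (\<psi> j) (\<phi> j)"
    and ij: "i < N" "j < N"
  shows "((\<lambda>t. (l2_inner \<rho> (\<psi> i) (T t (\<psi> j)) - l2_inner \<rho> (\<psi> i) (\<psi> j)) / t)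
    \<longlongrightarrow> l2_inner \<rho> (\<psi> i) (\<phi> j)) (at_right 0)"
proof (rule Lim_null[THEN iffD2], rule Lim_null_comparison)
  let ?e = "\<lambda>t x. (T t (\<psi> j) x - \<psi> j x) / t - \<phi> j x"
  show "((\<lambda>t. l2_norm \<rho> (\<psi> i) * l2_norm \<rho> (?e t)) \<longlongrightarrow> 0) (at_right 0)"
    using gen unfolding has_generator_def by (intro tendsto_mult_right_zero) auto
  show "\<forall>\<^sub>F t in at_right 0. norm ((l2_inner \<rho> (\<psi> i) (T t (\<psi> j)) - l2_inner \<rho> (\<psi> i) (\<psi> j)) / t
      - l2_inner \<rho> (\<psi> i) (\<phi> j)) \<le> l2_norm \<rho> (\<psi> i) * l2_norm \<rho> (?e t)"
    using eventually_at_right_less[of "0::real"]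
  proof eventually_elim
    case (elim t)
    have L2: "T t (\<psi> j) \<in> L2 \<rho>" "\<psi> i \<in> L2 \<rho>" "\<psi> j \<in> L2 \<rho>" "\<phi> j \<in> L2 \<rho>"
      using T[of t] elim ij gen psi_L2 by (auto simp: L2_bounded_linear_def has_generator_def)
    then have "(l2_inner \<rho> (\<psi> i) (T t (\<psi> j)) - l2_inner \<rho> (\<psi> i) (\<psi> j)) / t - l2_inner \<rho> (\<psi> i) (\<phi> j)
        = l2_inner \<rho> (\<psi> i) (?e t)"
      by (simp add: l2_inner_diff_right l2_inner_divide_right L2_diff L2_divide)
    then show ?case
      using l2_Cauchy_Schwarz[of "\<psi> i" \<rho> "?e t"] L2 by (simp add: L2_diff L2_divide)
  qed
qed

theorem theorem4p8:
  fixes M \<O> :: "'a::euclidean_space set"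
    and P :: "'w measure" and Filt :: "real \<Rightarrow> 'w measure"
    and W :: "real \<Rightarrow> 'w \<Rightarrow> 'b::euclidean_space"
    and b :: "'a \<Rightarrow> 'a" and \<sigma> :: "'a \<Rightarrow> 'b \<Rightarrow>\<^sub>L 'a"
    and X :: "'a \<Rightarrow> real \<Rightarrow> 'w \<Rightarrow> 'a"
    and \<rho> :: "'a measure"
    and S :: "'s measure" and \<xi> :: "nat \<Rightarrow> 's \<Rightarrow> 'a"
    and N :: nat and \<psi> A\<psi> :: "nat \<Rightarrow> 'a \<Rightarrow> real"
    and C L :: real
  assumes process: "diffusion_process M P Filt W b \<sigma> X"
    and rho: "prob_space \<rho>" "sets \<rho> = sets (restrict_space borel M)"
    and semigroup: "koopman_semigroup \<rho> P X"
    and samples: "iid_samples S \<rho> \<xi>"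
    and N: "N > 0"
    and domain: "\<And>i. i < N \<Longrightarrow> has_generator \<rho> (koopman P X) (\<psi> i) (A\<psi> i)"
    and indep: "dict_independent \<rho> N \<psi>"
    and compact: "compact \<O>" "\<O> \<subseteq> M"
    and contains: "AE s in S. \<forall>k. \<xi> k s \<in> \<O>"
    and CL: "C > 0" "L > 0"
    and bound_psi: "\<And>i x. i < N \<Longrightarrow> x \<in> \<O> \<Longrightarrow> \<bar>\<psi> i x\<bar> \<le> C"
    and bound_Apsi: "\<And>i x. i < N \<Longrightarrow> x \<in> \<O> \<Longrightarrow> \<bar>A\<psi> i x\<bar> \<le> L"
  shows "((\<lambda>\<Delta>t. dict_opnorm \<rho> N \<psi>
            (\<lambda>f x. data_driven_generator S \<xi> (koopman P X) N \<psi> A\<psi> \<Delta>t f x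
                   - compressed_generator \<rho> (koopman P X) N \<psi> f x)) \<longlongrightarrow> 0) (at_right 0)"
proof -
  define T where "T = koopman P X"
  have gen: "has_generator \<rho> T (\<psi> i) (A\<psi> i)" if "i < N" for i
    using domain[OF that] by (simp add: T_def)
  have T: "L2_bounded_linear \<rho> (T t)" if "t \<ge> 0" for t
    using semigroup that by (simp add: koopman_semigroup_def L2_C0_semigroup_def T_def)
  interpret L2_dictionary \<rho> N \<psi>
    using gen indep by unfold_locales (auto simp: has_generator_def)
  \<comment> \<open>The bound is assumed on \<O>, where the samples lie almost surely. Since
    \<open>\<xi> 0\<close> has law \<rho>, it transfers to \<rho>-almost every point.\<close>
  have bound: "AE x in \<rho>. \<bar>\<psi> i x\<bar> \<le> C" if i: "i < N" for i
  proof -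
    have \<xi>: "\<xi> 0 \<in> measurable S \<rho>" and distr: "distr S \<rho> (\<xi> 0) = \<rho>"
      using samples by (auto simp: iid_samples_def prob_space.indep_vars_def)
    have [measurable]: "\<psi> i \<in> borel_measurable \<rho>"
      using psi_L2[OF i] by (rule L2_measurable)
    have "AE s in S. \<bar>\<psi> i (\<xi> 0 s)\<bar> \<le> C"
      using contains by eventually_elim (use bound_psi i in auto)
    then have "AE x in distr S \<rho> (\<xi> 0). \<bar>\<psi> i x\<bar> \<le> C"
      by (subst AE_distr_iff[OF \<xi>]) auto
    then show ?thesis unfolding distr .
  qed
  define B where "B t = inner_mat (\<lambda>j. T t (\<psi> j))" for t
  define H where "H = gram_inv * inner_mat A\<psi>"
  \<comment> \<open>The coefficient matrix of the difference of the two operators on the span, so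
    its entries have to tend to 0.\<close>
  define E where "E t = (1 / t) \<cdot>\<^sub>m (gram_inv * B t - 1\<^sub>m N) - H" for t
  have H: "H \<in> carrier_mat N N" and B: "B t \<in> carrier_mat N N" for t
    by (simp_all add: H_def B_def)
  have GB: "gram_inv * B t \<in> carrier_mat N N" for t
    using B by simp
  have "((\<lambda>t. dict_opnorm \<rho> N \<psi> (\<lambda>f x. data_driven_generator S \<xi> T N \<psi> A\<psi> t f x
      - compressed_generator \<rho> T N \<psi> f x)) \<longlongrightarrow> 0) (at_right 0)"
  proof (rule dict_opnorm_tendsto_0[where E = E])
    show "E t \<in> carrier_mat N N" for t
      unfolding E_def by (rule minus_carrier_mat[OF H])
    show "\<forall>\<^sub>F t in at_right 0. \<forall>a\<in>carrier_vec N.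
        (\<lambda>x. data_driven_generator S \<xi> T N \<psi> A\<psi> t (dict_comb N \<psi> a) x
          - compressed_generator \<rho> T N \<psi> (dict_comb N \<psi> a) x) = dict_comb N \<psi> (E t *\<^sub>v a)"
      using eventually_at_right_less[of "0::real"]
    proof eventually_elim
      case (elim t)
      have "limit_matrix S \<xi> T N \<psi> A\<psi> t = gram_inv * B t"
        unfolding B_def using T[of t] elim psi_L2 bound
        by (intro limit_matrix_eq[OF samples]) (auto simp: L2_bounded_linear_def)
      then have gm: "generator_matrix S \<xi> T N \<psi> A\<psi> t = (1 / t) \<cdot>\<^sub>m (gram_inv * B t - 1\<^sub>m N)"
        by (simp add: generator_matrix_def)
      define A where "A = (1 / t) \<cdot>\<^sub>m (gram_inv * B t - 1\<^sub>m N)"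
      have A: "A \<in> carrier_mat N N" unfolding A_def by (intro smult_carrier_mat minus_carrier_mat one_carrier_mat)
      show ?case
      proof
        fix a :: "real vec" assume a: "a \<in> carrier_vec N"
        have "E t *\<^sub>v a = A *\<^sub>v a - H *\<^sub>v a"
          unfolding E_def A_def[symmetric] using A H a by (rule minus_mult_distrib_mat_vec)
        then show "(\<lambda>x. data_driven_generator S \<xi> T N \<psi> A\<psi> t (dict_comb N \<psi> a) x
          - compressed_generator \<rho> T N \<psi> (dict_comb N \<psi> a) x) = dict_comb N \<psi> (E t *\<^sub>v a)"
          using A H a
          by (simp add: data_driven_generator_def dict_coeffs_comb gm A_def[symmetric] H_def[symmetric]
              compressed_generator_comb[OF T gen] dict_comb_diff)
      qed
    qed
    fix i j assume ij: "i < N" "j < N"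
    \<comment> \<open>Writing the identity as \<open>gram_inv * gram\<close> lets
      \<open>gram_inv\<close> be factored out, leaving it applied to difference quotients of inner
      products.\<close>
    have one: "(1\<^sub>m N :: real mat) $$ (i, j) = (gram_inv * gram) $$ (i, j)"
      by (simp add: inv_mat_left[OF inner_mat_carrier det_gram])
    have entry: "E t $$ (i, j) = (\<Sum>k<N. gram_inv $$ (i, k) *
        ((l2_inner \<rho> (\<psi> k) (T t (\<psi> j)) - l2_inner \<rho> (\<psi> k) (\<psi> j)) / t)) - H $$ (i, j)" for t
    proof -
      have "E t $$ (i, j) = 1 / t * ((gram_inv * B t) $$ (i, j) - (gram_inv * gram) $$ (i, j)) - H $$ (i, j)"
        unfolding E_def using ij GB[of t] H one by simp
      also have "(gram_inv * B t) $$ (i, j) = (\<Sum>k<N. gram_inv $$ (i, k) * l2_inner \<rho> (\<psi> k) (T t (\<psi> j)))"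
        using ij by (subst mult_mat_entry[OF gram_inv_carrier B]) (auto simp: B_def)
      also have "(gram_inv * gram) $$ (i, j) = (\<Sum>k<N. gram_inv $$ (i, k) * l2_inner \<rho> (\<psi> k) (\<psi> j))"
        using ij by (subst mult_mat_entry[OF gram_inv_carrier inner_mat_carrier]) auto
      finally show ?thesis
        by (simp add: sum_divide_distrib right_diff_distrib diff_divide_distrib sum_subtractf)
    qed
    have "(\<Sum>k<N. gram_inv $$ (i, k) * l2_inner \<rho> (\<psi> k) (A\<psi> j)) = H $$ (i, j)"
      unfolding H_def using ij
      by (subst mult_mat_entry[OF gram_inv_carrier inner_mat_carrier]) auto
    moreover have "((\<lambda>t. \<Sum>k<N. gram_inv $$ (i, k) *
        ((l2_inner \<rho> (\<psi> k) (T t (\<psi> j)) - l2_inner \<rho> (\<psi> k) (\<psi> j)) / t))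
        \<longlongrightarrow> (\<Sum>k<N. gram_inv $$ (i, k) * l2_inner \<rho> (\<psi> k) (A\<psi> j))) (at_right 0)"
      using ij by (intro tendsto_sum tendsto_mult tendsto_const tendsto_inner_mat_quotient[OF T gen]) auto
    ultimately show "((\<lambda>t. E t $$ (i, j)) \<longlongrightarrow> 0) (at_right 0)"
      unfolding entry by (intro LIM_zero) (simp only:)
  qed
  then show ?thesis by (simp add: T_def)
qed

end
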